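(* For all integers $k \geq 3$ and $r \geq 3$, $$ s_r(K_k) \leq 8 (k-1)^6 r^3 .$$
   Context: All graphs are finite and simple. For graphs $G,H$ and an integer $r\ge 1$, write $G \rightarrow (H)_r$ if every colouring of the edges of $G$ with $r$ colours contains a monochromatic copy of $H$. A graph $G$ is $r$-Ramsey-minimal for $H$ if $G \rightarrow (H)_r$ but no proper subgraph $G' \subsetneq G$ satisfies $G' \rightarrow (H)_r$. Define $s_r(H) := \min \delta(G)$, the minimum taken over all graphs $G$ that are $r$-Ramsey-minimal for $H$, where $\delta(G)$ is the minimum degree. $K_k$ denotes the complete graph on $k$ vertices. *)

theory Defs
  imports Main
begin

type_synonym 'a graph = "'a set \<times> 'a set set"

definition verts :: "'a graph \<Rightarrow> 'a set" where "verts G = fst G"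
definition edges :: "'a graph \<Rightarrow> 'a set set" where "edges G = snd G"

definition graph :: "'a graph \<Rightarrow> bool" where
  "graph G \<longleftrightarrow> finite (verts G) \<and>
     (\<forall>e \<in> edges G. e \<subseteq> verts G \<and> card e = 2)"

definition subgraph :: "'a graph \<Rightarrow> 'a graph \<Rightarrow> bool" where
  "subgraph G' G \<longleftrightarrow> graph G' \<and> verts G' \<subseteq> verts G \<and> edges G' \<subseteq> edges G"

definition degree :: "'a graph \<Rightarrow> 'a \<Rightarrow> nat" where
  "degree G v = card {e \<in> edges G. v \<in> e}"

definition min_degree :: "'a graph \<Rightarrow> nat" where
  "min_degree G = Min (degree G ` verts G)"

definition complete_graph :: "nat \<Rightarrow> nat graph" where
  "complete_graph k = ({..<k}, {e. e \<subseteq> {..<k} \<and> card e = 2})"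

definition mono_copy :: "'b graph \<Rightarrow> 'a graph \<Rightarrow> ('a set \<Rightarrow> nat) \<Rightarrow> bool" where
  "mono_copy H G col \<longleftrightarrow>
     (\<exists>f c. inj_on f (verts H) \<and> f ` verts H \<subseteq> verts G \<and>
        (\<forall>e \<in> edges H. f ` e \<in> edges G \<and> col (f ` e) = c))"

definition arrows :: "'a graph \<Rightarrow> 'b graph \<Rightarrow> nat \<Rightarrow> bool" where
  "arrows G H r \<longleftrightarrow>
     (\<forall>col. (\<forall>e \<in> edges G. col e < r) \<longrightarrow> mono_copy H G col)"

definition ramsey_minimal :: "nat \<Rightarrow> 'b graph \<Rightarrow> 'a graph \<Rightarrow> bool" where
  "ramsey_minimal r H G \<longleftrightarrow> graph G \<and> arrows G H r \<and>
     (\<forall>G'. subgraph G' G \<and> G' \<noteq> G \<longrightarrow> \<not> arrows G' H r)"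

text \<open>s_r(H): the minimum of the minimum degrees of r-Ramsey-minimal graphs for H
  (graphs taken up to isomorphism, i.e. with vertices in nat).\<close>
definition s_ramsey :: "nat \<Rightarrow> 'b graph \<Rightarrow> nat" where
  "s_ramsey r H = Inf {min_degree G | G :: nat graph. ramsey_minimal r H G}"

end

theory Submission
  imports Defs "HOL-Algebra.Algebraic_Closure_Type" "HOL-Library.Z2" "HOL-Library.Ramsey"
    "HOL-Library.Countable"
begin

text \<open>
  Write \<open>m = k - 1\<close>. The bound comes from a vertex \<open>v\<close> joined to a set of \<open>n\<close> vertices that carries
  edge-disjoint \<open>K\<^sub>k\<close>-free graphs \<open>G\<^sub>i\<close>, \<open>i < r\<close>, such that every vertex colouring with \<open>r\<close> colours
  has, for some \<open>i\<close>, a copy of \<open>K\<^sub>m\<close> in \<open>G\<^sub>i\<close> all of whose vertices have colour \<open>i\<close>. If \<open>G\<^sub>i\<close> has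
  edge colour \<open>i\<close>, then the colours of the edges at \<open>v\<close> cannot avoid a monochromatic \<open>K\<^sub>k\<close>.

  Such \<open>G\<^sub>i\<close> exist for \<open>n = q\<^sup>3\<close> with \<open>q\<close> a power of two between \<open>m\<^sup>2 r\<close> and \<open>2 m\<^sup>2 r\<close>: in the affine space
  over the field with \<open>q\<close> elements, the lines with directions \<open>(1, x, x\<^sup>2 + t)\<close> form no triangle, and
  on each line one puts a complete \<open>m\<close>-partite graph. Different values of \<open>t\<close> give disjoint graphs, and
  counting shows that for some choice of the partitions every set of at least \<open>n / r\<close> points meets all
  \<open>m\<close> parts of some line.

  It remains to find a graph \<open>F\<close> that has a colouring without monochromatic \<open>K\<^sub>k\<close>, while each such
  colouring of \<open>F\<close> contains the pattern \<open>(G\<^sub>i)\<close> up to a permutation of the colours; then one attaches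
  a vertex \<open>v\<close> to every \<open>n\<close>-subset of \<open>F\<close>, and a minimal subgraph must use one of these vertices.
  First replace graphs by colourings of all pairs of a finite set \<open>W\<close> in which only some \<open>k\<close>-sets are
  required not to be monochromatic. There the pattern can be forced: in a minimal family of \<open>k\<close>-sets
  with the Ramsey property, dropping one set \<open>K0\<close> forces \<open>K0\<close> to be monochromatic in every admissible
  colouring. The partite construction of Nesetril and Rodl, based on the Hales--Jewett theorem, then
  turns such a set system into a graph over \<open>W\<close> whose \<open>k\<close>-cliques lie only over the required sets.
\<close>

section \<open>The Hales--Jewett theorem\<close>

definition words :: "'a set \<Rightarrow> nat \<Rightarrow> 'a list set" where
  "words S n = {w. length w = n \<and> set w \<subseteq> S}"

text \<open>\<open>None\<close> is the variable, and a variable word encodes a combinatorial line.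
  At least one \<open>None\<close> must occur, since otherwise the line would be a single
  word.\<close>

definition var_words :: "'a set \<Rightarrow> nat \<Rightarrow> 'a option list set" where
  "var_words S n = {v. length v = n \<and> None \<in> set v \<and> set v \<subseteq> insert None (Some ` S)}"

definition inst_word :: "'a \<Rightarrow> 'a option list \<Rightarrow> 'a list" where
  "inst_word x v = map (case_option x (\<lambda>y. y)) v"

lemma inst_word_append [simp]: "inst_word x (u @ v) = inst_word x u @ inst_word x v"
  by (simp add: inst_word_def)

lemma inst_word_Some [simp]: "inst_word x (map Some w) = w"
  by (induction w) (auto simp: inst_word_def)

lemma inst_word_in_words:
  assumes "v \<in> var_words S n" "x \<in> S"
  shows "inst_word x v \<in> words S n"
  using assms by (fastforce simp: var_words_def words_def inst_word_def split: option.splits)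

lemma finite_words: "finite S \<Longrightarrow> finite (words S n)"
  unfolding words_def by (rule finite_subset[OF _ finite_lists_length_eq[of S n]]) auto

lemma finite_var_words: "finite S \<Longrightarrow> finite (var_words S n)"
  unfolding var_words_def
  by (rule finite_subset[OF _ finite_lists_length_eq[of "insert None (Some ` S)" n]]) auto

lemma var_words_mono: "S \<subseteq> T \<Longrightarrow> var_words S n \<subseteq> var_words T n"
  by (auto simp: var_words_def)

lemma append_in_words: "u \<in> words S m \<Longrightarrow> w \<in> words S n \<Longrightarrow> u @ w \<in> words S (m + n)"
  by (auto simp: words_def)

definition hj_number :: "'a set \<Rightarrow> nat \<Rightarrow> nat \<Rightarrow> bool" where
  "hj_number S r n \<longleftrightarrow> (\<forall>c :: 'a list \<Rightarrow> nat. (\<forall>w \<in> words S n. c w < r) \<longrightarrow>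
     (\<exists>v \<in> var_words S n. \<exists>d. \<forall>x \<in> S. c (inst_word x v) = d))"

text \<open>Numbering the elements of \<open>C\<close> lets any finite set serve as colours. The
  induction below takes functions as colours.\<close>

lemma hj_number_finite_colours:
  assumes "hj_number S (card C) n" "finite C" "\<And>w. w \<in> words S n \<Longrightarrow> c w \<in> C"
  shows "\<exists>v \<in> var_words S n. \<exists>d. \<forall>x \<in> S. c (inst_word x v) = d"
proof -
  obtain f where f: "bij_betw f C {0..<card C}"
    using ex_bij_betw_finite_nat[OF assms(2)] by blast
  have "\<forall>w \<in> words S n. (f \<circ> c) w < card C"
    using bij_betwE[OF f] assms(3) by auto
  then obtain v d where v: "v \<in> var_words S n" "\<And>x. x \<in> S \<Longrightarrow> f (c (inst_word x v)) = d"
    using assms(1) unfolding hj_number_def by (metis comp_apply)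
  have "c (inst_word x v) = c (inst_word y v)" if "x \<in> S" "y \<in> S" for x y
    using v that assms(3) inst_word_in_words[OF v(1)] bij_betw_imp_inj_on[OF f]
    by (metis inj_onD)
  then show ?thesis using v(1) by metis
qed

text \<open>Colour focusing: one builds more and more variable words that have pairwise different colours on
  the smaller alphabet and all take the same value \<open>f\<close> at the additional letter \<open>s\<close>. With \<open>r\<close> such
  words, the colour of \<open>f\<close> must agree with one of them.\<close>
theorem hales_jewett:
  assumes "finite S"
  shows "\<exists>n. hj_number S r n"
  using assms
proof (induction S arbitrary: r rule: finite_induct)
  case empty
  have "[None] \<in> var_words {} 1" by (auto simp: var_words_def)
  then show ?case unfolding hj_number_def by (intro exI[of _ 1]) auto
next
  case (insert s S r)
  let ?T = "insert s S"
  show ?case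
  proof (cases "S = {}")
    case True
    have "[None] \<in> var_words ?T 1" by (auto simp: var_words_def)
    then show ?thesis unfolding hj_number_def True by (intro exI[of _ 1]) auto
  next
    case False
    then obtain x0 where x0: "x0 \<in> S" by blast
    define has_mono where "has_mono n c \<longleftrightarrow> (\<exists>v \<in> var_words ?T n. \<exists>d. \<forall>x \<in> ?T. c (inst_word x v) = d)"
      for n and c :: "'a list \<Rightarrow> nat"
    \<comment> \<open>Indexing the words by the colour \<open>d\<close> of their instances over
      \<open>S\<close> makes these colours pairwise different.\<close>
    define focused where "focused n c j \<longleftrightarrow> (\<exists>D V f. D \<subseteq> {..<r} \<and> card D = j \<and> f \<in> words ?T n \<and>
        (\<forall>d \<in> D. V d \<in> var_words ?T n \<and> inst_word s (V d) = f \<and>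
          (\<forall>x \<in> S. c (inst_word x (V d)) = d)))" for n and c :: "'a list \<Rightarrow> nat" and j
    have claim: "\<exists>n. \<forall>c. (\<forall>w \<in> words ?T n. c w < r) \<longrightarrow> has_mono n c \<or> focused n c j" for j
    proof (induction j)
      case 0
      have "focused 0 c 0" for c
        unfolding focused_def by (intro exI[of _ "{}"] exI[of _ "[]"]) (auto simp: words_def)
      then show ?case by blast
    next
      case (Suc j)
      then obtain m where m: "\<And>c. (\<And>w. w \<in> words ?T m \<Longrightarrow> c w < r) \<Longrightarrow> has_mono m c \<or> focused m c j"
        by blast
      \<comment> \<open>A prefix is coloured by the whole colouring that it induces on the tails of
        length \<open>m\<close>; \<open>C\<close> contains these colours.\<close>
      define C where "C = words ?T m \<rightarrow>\<^sub>E {..<r}"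
      have finC: "finite C"
        unfolding C_def using finite_words[of ?T m] insert.hyps(1) by (intro finite_PiE) auto
      obtain n where n: "hj_number S (card C) n" using insert.IH by blast
      show ?case
      proof (intro exI[of _ "n + m"] allI impI)
        fix c :: "'a list \<Rightarrow> nat"
        assume c: "\<forall>w \<in> words ?T (n + m). c w < r"
        have ST: "words S n \<subseteq> words ?T n" by (auto simp: words_def)
        have "(\<lambda>w \<in> words ?T m. c (u @ w)) \<in> C" if "u \<in> words S n" for u
          using that c append_in_words ST unfolding C_def by fastforce
        then obtain U d0 where U: "U \<in> var_words S n"
          "\<And>x. x \<in> S \<Longrightarrow> (\<lambda>w \<in> words ?T m. c (inst_word x U @ w)) = d0"
          using hj_number_finite_colours[OF n finC, of "\<lambda>u. \<lambda>w \<in> words ?T m. c (u @ w)"] by blast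
        have UT: "U \<in> var_words ?T n" using U(1) var_words_mono[of S ?T] by blast
        \<comment> \<open>By the choice of \<open>U\<close>, all letters of \<open>S\<close> induce
          the same colouring of the tails, and \<open>x0\<close> represents them.\<close>
        define c' where "c' w = c (inst_word x0 U @ w)" for w
        have U': "c (inst_word x U @ w) = c' w" if "x \<in> S" "w \<in> words ?T m" for x w
          using U(2)[OF that(1)] U(2)[OF x0] that(2) unfolding c'_def by (metis restrict_apply')
        have c': "c' w < r" if "w \<in> words ?T m" for w
          using c append_in_words[OF inst_word_in_words[OF UT] that, of x0] x0
          unfolding c'_def by blast
        have app: "map Some (inst_word x0 U) @ v \<in> var_words ?T (n + m)" if "v \<in> var_words ?T m" for v
          using that inst_word_in_words[OF UT, of x0] x0 by (auto simp: var_words_def words_def)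
        have mono': "has_mono (n + m) c" if mc': "has_mono m c'"
        proof -
          obtain v d where v: "v \<in> var_words ?T m" "\<And>x. x \<in> ?T \<Longrightarrow> c' (inst_word x v) = d"
            using mc' unfolding has_mono_def by metis
          then have "\<forall>x \<in> ?T. c (inst_word x (map Some (inst_word x0 U) @ v)) = d"
            unfolding c'_def by simp
          then show ?thesis unfolding has_mono_def using app[OF v(1)] by blast
        qed
        show "has_mono (n + m) c \<or> focused (n + m) c (Suc j)"
        proof (cases "has_mono m c'")
          case True
          then show ?thesis using mono' by blast
        next
          case not_mono: False
          then obtain D V f where D: "D \<subseteq> {..<r}" "card D = j" and f: "f \<in> words ?T m"
            and V: "\<And>d. d \<in> D \<Longrightarrow> V d \<in> var_words ?T m"
              "\<And>d. d \<in> D \<Longrightarrow> inst_word s (V d) = f"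
              "\<And>d x. d \<in> D \<Longrightarrow> x \<in> S \<Longrightarrow> c' (inst_word x (V d)) = d"
            using m[of c', OF c'] unfolding focused_def by metis
          \<comment> \<open>If the colour of the focus \<open>f\<close> already occurred, the word
            with this colour would be monochromatic over all of \<open>?T\<close>.\<close>
          have new: "c' f \<notin> D"
          proof
            assume "c' f \<in> D"
            then have "\<forall>x \<in> ?T. c' (inst_word x (V (c' f))) = c' f" using V by auto
            then show False using not_mono V(1)[OF \<open>c' f \<in> D\<close>] unfolding has_mono_def by blast
          qed
          \<comment> \<open>The old words get the variable in the prefix as well, and the new word
            has it there only. All of them take the value \<open>inst_word s U @ f\<close> at
            \<open>s\<close>.\<close>
          define V' where "V' d = U @ (if d = c' f then map Some f else V d)" for d
          have Sf: "set f \<subseteq> ?T" "length f = m" using f by (auto simp: words_def)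
          have V'_in: "V' d \<in> var_words ?T (n + m)" if "d \<in> insert (c' f) D" for d
            using that UT V(1)[of d] Sf unfolding V'_def var_words_def by auto
          have V'_s: "inst_word s (V' d) = inst_word s U @ f" if "d \<in> insert (c' f) D" for d
            using that V(2)[of d] unfolding V'_def by auto
          have V'_c: "c (inst_word x (V' d)) = d" if "d \<in> insert (c' f) D" "x \<in> S" for d x
            using that V(3)[of d x] U'[OF that(2)] f new inst_word_in_words[OF V(1)[of d], of x]
            unfolding V'_def by auto
          have "finite D" using D(1) finite_subset by blast
          then have "card (insert (c' f) D) = Suc j" using D(2) new by simp
          moreover have "insert (c' f) D \<subseteq> {..<r}" using D(1) c'[OF f] by auto
          moreover have "inst_word s U @ f \<in> words ?T (n + m)"
            using append_in_words[OF inst_word_in_words[OF UT] f, of s] by blast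
          ultimately have "focused (n + m) c (Suc j)"
            unfolding focused_def using V'_in V'_s V'_c
            by (intro exI[of _ "insert (c' f) D"] exI[of _ V'] exI[of _ "inst_word s U @ f"]) simp
          then show ?thesis ..
        qed
      qed
    qed
    obtain n where n: "\<And>c. (\<And>w. w \<in> words ?T n \<Longrightarrow> c w < r) \<Longrightarrow> has_mono n c \<or> focused n c r"
      using claim by blast
    have "has_mono n c" if c: "\<And>w. w \<in> words ?T n \<Longrightarrow> c w < r" for c
    proof (rule ccontr)
      assume "\<not> has_mono n c"
      then obtain D V f where D: "D \<subseteq> {..<r}" "card D = r" and f: "f \<in> words ?T n"
        and V: "\<And>d. d \<in> D \<Longrightarrow> V d \<in> var_words ?T n"
          "\<And>d. d \<in> D \<Longrightarrow> inst_word s (V d) = f"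
          "\<And>d x. d \<in> D \<Longrightarrow> x \<in> S \<Longrightarrow> c (inst_word x (V d)) = d"
        using n[of c, OF c] unfolding focused_def by metis
      have "D = {..<r}" using D by (intro card_subset_eq) auto
      then have cf: "c f \<in> D" using c[OF f] by simp
      then have "\<forall>x \<in> ?T. c (inst_word x (V (c f))) = c f" using V by auto
      then show False using \<open>\<not> has_mono n c\<close> V(1)[OF cf] unfolding has_mono_def by blast
    qed
    then show ?thesis unfolding hj_number_def has_mono_def by blast
  qed
qed

section \<open>The partite construction\<close>

text \<open>The classes are the fibres of \<open>p\<close>. The family \<open>\<A>\<close> lists the
  sets of the base over which a \<open>k\<close>-clique is permitted; the construction preserves
  this condition while it enforces homogeneous colours.\<close>

definition partite :: "nat \<Rightarrow> 'w set set \<Rightarrow> 'v set \<Rightarrow> 'v set set \<Rightarrow> ('v \<Rightarrow> 'w) \<Rightarrow> bool" where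
  "partite k \<A> V E p \<longleftrightarrow> finite V \<and> E \<subseteq> [V]\<^bsup>2\<^esup> \<and> (\<forall>e \<in> E. inj_on p e) \<and>
     (\<forall>Q. Q \<subseteq> V \<longrightarrow> card Q = k \<longrightarrow> [Q]\<^bsup>2\<^esup> \<subseteq> E \<longrightarrow> p ` Q \<in> \<A>)"

text \<open>Copies respect the classes but need not be induced.\<close>

definition partite_copy :: "'v set \<Rightarrow> 'v set set \<Rightarrow> ('v \<Rightarrow> 'w) \<Rightarrow>
    'u set \<Rightarrow> 'u set set \<Rightarrow> ('u \<Rightarrow> 'w) \<Rightarrow> ('v \<Rightarrow> 'u) \<Rightarrow> bool" where
  "partite_copy V E p V' E' p' h \<longleftrightarrow> inj_on h V \<and> h ` V \<subseteq> V' \<and>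
     (\<forall>v \<in> V. p' (h v) = p v) \<and> (\<forall>e \<in> E. h ` e \<in> E')"

lemma partite_copy_comp:
  assumes "partite_copy V E p V' E' p' g" "partite_copy V' E' p' V'' E'' p'' h"
  shows "partite_copy V E p V'' E'' p'' (h \<circ> g)"
proof -
  have "(h \<circ> g) ` e = h ` g ` e" for e by (simp add: image_comp)
  moreover have "inj_on (h \<circ> g) V"
    using assms by (auto simp: partite_copy_def intro: comp_inj_on inj_on_subset)
  ultimately show ?thesis using assms unfolding partite_copy_def by (auto simp: image_subset_iff)
qed

lemma partite_edge:
  assumes "partite k \<A> V E p" "e \<in> E"
  obtains x y where "e = {x, y}" "x \<in> V" "y \<in> V" "x \<noteq> y" "p x \<noteq> p y"
proof -
  have "e \<in> [V]\<^bsup>2\<^esup>" "inj_on p e" using assms by (auto simp: partite_def)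
  then obtain x y where "e = {x, y}" "x \<in> V" "y \<in> V" "x \<noteq> y" by (elim nsets2_E) auto
  with \<open>inj_on p e\<close> that show thesis by (auto simp: inj_on_def)
qed

text \<open>The bipartite graph between the classes over \<open>a\<close> and \<open>b\<close> is replaced by its \<open>N\<close>-th power, and
  a copy of the whole graph is attached freely to each combinatorial line of edges. Each copy is
  induced, so a clique with a vertex outside the two classes lies in a single copy.\<close>
lemma partite_step:
  fixes V :: "nat set" and p :: "nat \<Rightarrow> 'w" and r :: nat
  assumes P: "partite k \<A> V E p" and k: "k \<ge> 3" and ab: "a \<noteq> b" and r: "r > 0"
  shows "\<exists>V' E' p'. partite k \<A> (V' :: nat set) E' p' \<and>
    (\<forall>\<chi>. (\<forall>e \<in> E'. \<chi> e < r) \<longrightarrow> (\<exists>h c. partite_copy V E p V' E' p' h \<and>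
       (\<forall>e \<in> E. p ` e = {a, b} \<longrightarrow> \<chi> (h ` e) = c)))"
proof -
  have finV: "finite V" using P by (simp add: partite_def)
  \<comment> \<open>The alphabet is the set of edges between the two classes, oriented from
    \<open>a\<close> to \<open>b\<close>.\<close>
  define S where "S = {(x, y). x \<in> V \<and> y \<in> V \<and> p x = a \<and> p y = b \<and> {x, y} \<in> E}"
  have finS: "finite S" by (rule finite_subset[of _ "V \<times> V"]) (auto simp: S_def finV)
  obtain N where N: "hj_number S r N" using hales_jewett[OF finS] by blast
  \<comment> \<open>Over \<open>a\<close> and \<open>b\<close> the new vertices are words, while
    every other vertex carries the label \<open>L\<close> of its copy. Countability codes the three
    kinds disjointly in \<open>nat\<close>.\<close>
  define \<alpha> :: "nat list \<Rightarrow> nat" where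
    "\<alpha> u = to_nat (Inl u :: nat list + nat list + (nat \<times> nat) option list \<times> nat)" for u
  define \<beta> :: "nat list \<Rightarrow> nat" where
    "\<beta> u = to_nat (Inr (Inl u) :: nat list + nat list + (nat \<times> nat) option list \<times> nat)" for u
  define \<gamma> :: "(nat \<times> nat) option list \<Rightarrow> nat \<Rightarrow> nat" where
    "\<gamma> L v = to_nat (Inr (Inr (L, v)) :: nat list + nat list + (nat \<times> nat) option list \<times> nat)" for L v
  \<comment> \<open>A vertex over \<open>a\<close> or \<open>b\<close> fills the variable positions
    of \<open>L\<close>; the fixed letters contribute their endpoints in that class. Hence different
    copies meet only over \<open>a\<close> and \<open>b\<close>.\<close>
  define h where "h L v = (if p v = a then \<alpha> (map (case_option v fst) L)
     else if p v = b then \<beta> (map (case_option v snd) L) else \<gamma> L v)" for L v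
  define p' where "p' n = (case from_nat n :: nat list + nat list + (nat \<times> nat) option list \<times> nat of
      Inl u \<Rightarrow> a | Inr w \<Rightarrow> (case w of Inl u \<Rightarrow> b | Inr w \<Rightarrow> p (snd w)))" for n
  have enc: "\<alpha> u = \<alpha> u' \<longleftrightarrow> u = u'" "\<beta> u = \<beta> u' \<longleftrightarrow> u = u'" "\<gamma> L v = \<gamma> L' v' \<longleftrightarrow> L = L' \<and> v = v'"
    for u u' L L' v v'
    by (auto simp: \<alpha>_def \<beta>_def \<gamma>_def)
  have p'h: "p' (h L v) = p v" for L v
    by (auto simp: p'_def h_def \<alpha>_def \<beta>_def \<gamma>_def)
  define Ls where "Ls = var_words S N"
  define V' where "V' = (\<Union>L \<in> Ls. h L ` V)"
  define E' where "E' = (\<Union>L \<in> Ls. (`) (h L) ` E)"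
  have moving: "\<exists>i < length L. L ! i = None" if "L \<in> Ls" for L
    using that unfolding Ls_def var_words_def by (auto simp: in_set_conv_nth)
  have h_inj: "u = v" if "L \<in> Ls" "h L u = h L v" for L u v
  proof -
    have pp: "p u = p v" using that(2) p'h by metis
    have "None \<in> set L" using that(1) by (simp add: Ls_def var_words_def)
    then have "map f L = map g L \<Longrightarrow> f None = g None" for f g :: "(nat \<times> nat) option \<Rightarrow> nat"
      by (metis map_eq_conv)
    from this[of "case_option u fst" "case_option v fst"] this[of "case_option u snd" "case_option v snd"]
    show ?thesis using that(2) pp unfolding h_def by (auto simp: enc simp del: map_eq_conv split: if_splits)
  qed
  \<comment> \<open>Read both words at a position \<open>i\<close> where \<open>L\<close> has its
    variable. There \<open>L'\<close> has either its variable, which gives the edge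
    \<open>(x, y)\<close>, or a letter of \<open>S\<close>; in both cases \<open>(u, w)\<close> is
    an edge. This makes the copies induced.\<close>
  have key: "(u, w) \<in> S" if L: "L \<in> Ls" "L' \<in> Ls" and "(x, y) \<in> S" "p u = a" "p w = b"
    "h L' x = h L u" "h L' y = h L w" for L L' x y u w
  proof -
    obtain i where i: "i < length L" "L ! i = None" using moving L(1) by blast
    have S: "p x = a" "p y = b" using that(3) by (auto simp: S_def)
    have len: "length L = N" "length L' = N" using L by (auto simp: Ls_def var_words_def)
    have "map (case_option x fst) L' = map (case_option u fst) L"
      using that(6) S(1) that(4) by (simp add: h_def enc)
    then have "map (case_option x fst) L' ! i = map (case_option u fst) L ! i" by simp
    then have u: "u = case_option x fst (L' ! i)" using i len by simp
    have "map (case_option y snd) L' = map (case_option w snd) L"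
      using that(7) S(2) that(5) ab by (simp add: h_def enc)
    then have "map (case_option y snd) L' ! i = map (case_option w snd) L ! i" by simp
    then have w: "w = case_option y snd (L' ! i)" using i len by simp
    show ?thesis
    proof (cases "L' ! i")
      case None
      then show ?thesis using u w that(3) by simp
    next
      case (Some z)
      then have "Some z \<in> set L'" using i len by (metis nth_mem)
      then have "z \<in> S" using L(2) by (auto simp: Ls_def var_words_def)
      then show ?thesis using u w Some by simp
    qed
  qed
  have same: "L' = L \<and> x = u" if "h L' x = h L u" "p u \<noteq> a" "p u \<noteq> b" for L L' x u
  proof -
    have "p x = p u" using that(1) p'h by metis
    then show ?thesis using that by (simp add: h_def enc)
  qed
  have induced': "{u, w} \<in> E" if L: "L \<in> Ls" "L' \<in> Ls" and xy: "{x, y} \<in> E" "x \<in> V" "y \<in> V" "p x \<noteq> p y"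
    and eq: "h L' x = h L u" "h L' y = h L w" for L L' x y u w
  proof -
    have pp: "p x = p u" "p y = p w" using eq p'h by metis+
    consider "p u \<noteq> a \<and> p u \<noteq> b" | "p w \<noteq> a \<and> p w \<noteq> b" | "p u = a" "p w = b" | "p u = b" "p w = a"
      using pp xy by metis
    then show ?thesis
    proof cases
      case 1
      then have "L' = L" "x = u" using same eq(1) by blast+
      then show ?thesis using h_inj[OF L(1)] eq(2) xy(1) by blast
    next
      case 2
      then have "L' = L" "y = w" using same eq(2) by blast+
      then show ?thesis using h_inj[OF L(1)] eq(1) xy(1) by blast
    next
      case 3
      then have "(x, y) \<in> S" using xy pp by (simp add: S_def)
      then have "(u, w) \<in> S" using key[OF L] 3 eq by blast
      then show ?thesis by (simp add: S_def)
    next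
      case 4
      then have "(y, x) \<in> S" using xy pp by (simp add: S_def insert_commute)
      then have "(w, u) \<in> S" using key[OF L] 4 eq by blast
      then show ?thesis by (simp add: S_def insert_commute)
    qed
  qed
  have induced: "{u, w} \<in> E" if L: "L \<in> Ls" and e: "{h L u, h L w} \<in> E'" for L u w
  proof -
    obtain L' e where L': "L' \<in> Ls" "e \<in> E" "{h L u, h L w} = h L' ` e"
      using e unfolding E'_def by blast
    obtain x y where xy: "e = {x, y}" "x \<in> V" "y \<in> V" "p x \<noteq> p y"
      using partite_edge[OF P L'(2)] by metis
    have "h L' x = h L u \<and> h L' y = h L w \<or> h L' x = h L w \<and> h L' y = h L u"
      using L'(3) xy(1) by (auto simp: doubleton_eq_iff)
    then show ?thesis
      using induced'[OF L L'(1), of x y] L'(2) xy by (metis insert_commute)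
  qed
  have finLs: "finite Ls" unfolding Ls_def by (rule finite_var_words[OF finS])
  have part: "partite k \<A> V' E' p'"
    unfolding partite_def
  proof (intro conjI allI impI ballI)
    show "finite V'" unfolding V'_def using finLs finV by blast
    show "E' \<subseteq> [V']\<^bsup>2\<^esup>"
    proof
      fix e' assume "e' \<in> E'"
      then obtain L e where L: "L \<in> Ls" "e \<in> E" "e' = h L ` e" unfolding E'_def by blast
      obtain x y where xy: "e = {x, y}" "x \<in> V" "y \<in> V" "x \<noteq> y"
        using partite_edge[OF P L(2)] by metis
      then have "h L x \<noteq> h L y" "h L x \<in> V'" "h L y \<in> V'"
        using L(1) h_inj[OF L(1), of x y] unfolding V'_def by blast+
      then show "e' \<in> [V']\<^bsup>2\<^esup>" using L(3) xy(1) by simp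
    qed
    show inj: "inj_on p' e'" if "e' \<in> E'" for e'
    proof -
      obtain L e where L: "L \<in> Ls" "e \<in> E" "e' = h L ` e" using \<open>e' \<in> E'\<close> unfolding E'_def by blast
      obtain x y where xy: "e = {x, y}" "x \<in> V" "y \<in> V" "x \<noteq> y" "p x \<noteq> p y"
        using partite_edge[OF P L(2)] by metis
      then show ?thesis using L by (auto simp: p'h)
    qed
    fix Q assume Q: "Q \<subseteq> V'" "card Q = k" "[Q]\<^bsup>2\<^esup> \<subseteq> E'"
    have injQ: "inj_on p' Q"
    proof (rule inj_onI, rule ccontr)
      fix u w assume uw: "u \<in> Q" "w \<in> Q" "p' u = p' w" "u \<noteq> w"
      then have "{u, w} \<in> E'" using Q(3) by auto
      then show False using inj uw by (metis inj_onD insertI1 insertI2)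
    qed
    \<comment> \<open>\<open>p'\<close> is injective on the clique and \<open>k\<close> exceeds 2,
      so some vertex lies outside the two classes. Its label \<open>L\<close> determines the copy
      that contains all edges at it, hence all of \<open>Q\<close>.\<close>
    have "\<not> p' ` Q \<subseteq> {a, b}"
    proof
      assume "p' ` Q \<subseteq> {a, b}"
      then have "card (p' ` Q) \<le> card {a, b}" by (intro card_mono) auto
      then show False using card_image[OF injQ] Q(2) k ab by simp
    qed
    then obtain q where q: "q \<in> Q" "p' q \<noteq> a" "p' q \<noteq> b" by blast
    then obtain L z where L: "L \<in> Ls" "z \<in> V" "q = h L z" using Q(1) unfolding V'_def by blast
    have QL: "Q \<subseteq> h L ` V"
    proof
      fix q' assume "q' \<in> Q"
      show "q' \<in> h L ` V"
      proof (cases "q' = q")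
        case False
        then have "{q, q'} \<in> E'" using Q(3) q(1) \<open>q' \<in> Q\<close> by auto
        then obtain L' e where L': "L' \<in> Ls" "e \<in> E" "{q, q'} = h L' ` e" unfolding E'_def by blast
        have eV: "e \<subseteq> V" using P L'(2) by (auto simp: partite_def nsets_def)
        obtain x where x: "x \<in> e" "q = h L' x" using L'(3) by blast
        then have "L' = L" using same[of L' x L z] L(3) q p'h by metis
        then show ?thesis using L'(3) eV by blast
      qed (use L in blast)
    qed
    define Q0 where "Q0 = {v \<in> V. h L v \<in> Q}"
    have im: "h L ` Q0 = Q" using QL unfolding Q0_def by blast
    have "inj_on (h L) Q0" using h_inj[OF L(1)] by (auto intro: inj_onI)
    then have c0: "card Q0 = k" using im Q(2) card_image by metis
    have "[Q0]\<^bsup>2\<^esup> \<subseteq> E"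
    proof
      fix e assume "e \<in> [Q0]\<^bsup>2\<^esup>"
      then obtain u w where e: "e = {u, w}" "u \<in> Q0" "w \<in> Q0" "u \<noteq> w" by (elim nsets2_E) auto
      then have "{h L u, h L w} \<in> [Q]\<^bsup>2\<^esup>" using h_inj[OF L(1), of u w] unfolding Q0_def by auto
      then show "e \<in> E" using induced[OF L(1)] Q(3) e(1) by blast
    qed
    moreover have "Q0 \<subseteq> V" unfolding Q0_def by blast
    ultimately have "p ` Q0 \<in> \<A>" using P c0 unfolding partite_def by simp
    moreover have "p' ` Q = p ` Q0" unfolding im[symmetric] image_image p'h by simp
    ultimately show "p' ` Q \<in> \<A>" by simp
  qed
  have "\<exists>h c. partite_copy V E p V' E' p' h \<and> (\<forall>e \<in> E. p ` e = {a, b} \<longrightarrow> \<chi> (h ` e) = c)"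
    if \<chi>: "\<forall>e \<in> E'. \<chi> e < r" for \<chi>
  proof -
    define edge where "edge w = {\<alpha> (map fst w), \<beta> (map snd w)}" for w
    \<comment> \<open>The value 0 for words that give no edge of \<open>E'\<close> keeps all colours
      below \<open>r\<close>.\<close>
    define c where "c w = (if edge w \<in> E' then \<chi> (edge w) else 0)" for w
    have "\<forall>w \<in> words S N. c w < r" using \<chi> r unfolding c_def by simp
    then obtain L d where L: "L \<in> Ls" "\<And>s. s \<in> S \<Longrightarrow> c (inst_word s L) = d"
      using N unfolding hj_number_def Ls_def by blast
    have "partite_copy V E p V' E' p' (h L)"
      unfolding partite_copy_def V'_def E'_def using L(1) h_inj[OF L(1)] p'h
      by (auto intro: inj_onI)
    moreover have "\<chi> (h L ` e) = d" if e: "e \<in> E" "p ` e = {a, b}" for e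
    proof -
      obtain x' y' where xy': "e = {x', y'}" "x' \<in> V" "y' \<in> V"
        using partite_edge[OF P e(1)] by metis
      then have "p x' = a \<and> p y' = b \<or> p y' = a \<and> p x' = b"
        using e(2) by (auto simp: doubleton_eq_iff)
      then obtain x y where xy: "e = {x, y}" "x \<in> V" "y \<in> V" "p x = a" "p y = b"
        using xy' by (metis insert_commute)
      have "map fst (inst_word (x, y) L) = map (case_option x fst) L"
        "map snd (inst_word (x, y) L) = map (case_option y snd) L"
        unfolding inst_word_def by (auto split: option.splits)
      then have "edge (inst_word (x, y) L) = h L ` e"
        unfolding edge_def xy(1) h_def using xy ab by (simp add: insert_commute)
      moreover have "h L ` e \<in> E'" using L(1) e(1) unfolding E'_def by blast
      moreover have "(x, y) \<in> S" using xy e(1) by (simp add: S_def)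
      ultimately show ?thesis using L(2)[of "(x, y)"] unfolding c_def by simp
    qed
    ultimately show ?thesis by blast
  qed
  then show ?thesis using part by blast
qed

text \<open>Induction on the pairs \<open>Ds\<close>. The graph built for one pair enters the
  induction hypothesis as the starting graph. A colouring of the final graph is pulled back along
  the outer copy, and the inner copy keeps the homogeneity over the other pairs because copies
  commute with the projections.\<close>

lemma partite_iterate:
  fixes V :: "nat set" and p :: "nat \<Rightarrow> 'w" and r :: nat
  assumes "finite Ds" "Ds \<subseteq> [UNIV]\<^bsup>2\<^esup>" and P: "partite k \<A> V E p" and k: "k \<ge> 3" and r: "r > 0"
  shows "\<exists>V' E' p'. partite k \<A> (V' :: nat set) E' p' \<and>
    (\<forall>\<chi>. (\<forall>e \<in> E'. \<chi> e < r) \<longrightarrow> (\<exists>h \<psi>. partite_copy V E p V' E' p' h \<and>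
       (\<forall>e \<in> E. p ` e \<in> Ds \<longrightarrow> \<chi> (h ` e) = \<psi> (p ` e))))"
  using assms(1,2) P
proof (induction Ds arbitrary: V E p rule: finite_induct)
  case empty
  have "partite_copy V E p V E p id" by (simp add: partite_copy_def)
  then show ?case using empty.prems by blast
next
  case (insert D Ds)
  obtain a b where D: "D = {a, b}" "a \<noteq> b" using insert.prems(1) by (auto elim: nsets2_E)
  obtain V1 E1 p1 where 1: "partite k \<A> (V1 :: nat set) E1 p1"
    "\<And>\<chi>. (\<forall>e \<in> E1. \<chi> e < r) \<Longrightarrow> \<exists>h c. partite_copy V E p V1 E1 p1 h \<and>
       (\<forall>e \<in> E. p ` e = {a, b} \<longrightarrow> \<chi> (h ` e) = c)"
    using partite_step[OF insert.prems(2) k D(2) r] by metis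
  obtain V2 E2 p2 where 2: "partite k \<A> (V2 :: nat set) E2 p2"
    "\<And>\<chi>. (\<forall>e \<in> E2. \<chi> e < r) \<Longrightarrow> \<exists>h \<psi>. partite_copy V1 E1 p1 V2 E2 p2 h \<and>
       (\<forall>e \<in> E1. p1 ` e \<in> Ds \<longrightarrow> \<chi> (h ` e) = \<psi> (p1 ` e))"
    using insert.IH[OF _ 1(1)] insert.prems(1) by (metis insert_subset)
  have "\<exists>h \<psi>. partite_copy V E p V2 E2 p2 h \<and>
       (\<forall>e \<in> E. p ` e \<in> insert D Ds \<longrightarrow> \<chi> (h ` e) = \<psi> (p ` e))" if \<chi>: "\<forall>e \<in> E2. \<chi> e < r" for \<chi>
  proof -
    obtain h \<psi> where h: "partite_copy V1 E1 p1 V2 E2 p2 h"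
      "\<And>e. e \<in> E1 \<Longrightarrow> p1 ` e \<in> Ds \<Longrightarrow> \<chi> (h ` e) = \<psi> (p1 ` e)"
      using 2(2)[OF \<chi>] by blast
    have "\<forall>e \<in> E1. (\<lambda>e. \<chi> (h ` e)) e < r" using \<chi> h(1) by (auto simp: partite_copy_def)
    then obtain g c where g: "partite_copy V E p V1 E1 p1 g"
      "\<And>e. e \<in> E \<Longrightarrow> p ` e = {a, b} \<Longrightarrow> \<chi> (h ` g ` e) = c"
      using 1(2)[of "\<lambda>e. \<chi> (h ` e)"] by auto
    have "\<chi> ((h \<circ> g) ` e) = (\<psi>(D := c)) (p ` e)" if e: "e \<in> E" "p ` e \<in> insert D Ds" for e
    proof (cases "p ` e = D")
      case True
      then show ?thesis using g(2)[OF e(1)] D(1) by (simp add: image_comp)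
    next
      case False
      have "e \<subseteq> V" using insert.prems(2) e(1) by (auto simp: partite_def nsets_def)
      then have "p1 ` g ` e = p ` e"
        using g(1) by (force simp: partite_copy_def image_iff)
      moreover have "g ` e \<in> E1" using g(1) e(1) by (auto simp: partite_copy_def)
      ultimately show ?thesis using h(2)[of "g ` e"] False e(2) by (auto simp: image_comp)
    qed
    then show ?thesis using partite_copy_comp[OF g(1) h(1)] by blast
  qed
  then show ?case using 2(1) by blast
qed

text \<open>The starting graph is the disjoint union of the listed graphs, with \<open>p\<close>
  forgetting the index. Homogeneity over all projected pairs makes the colour of an edge in a
  suitable copy depend on its projection only, which gives one \<open>\<psi>\<close> for the whole
  list.\<close>

theorem partite_ramsey:
  fixes Ps :: "('w :: countable set \<times> 'w set set) list" and r :: nat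
  assumes k: "k \<ge> 3" and r: "r > 0"
    and Ps: "\<And>W F. (W, F) \<in> set Ps \<Longrightarrow> finite W \<and> F \<subseteq> [W]\<^bsup>2\<^esup>"
    and cl: "\<And>W F Q. (W, F) \<in> set Ps \<Longrightarrow> Q \<subseteq> W \<Longrightarrow> card Q = k \<Longrightarrow> [Q]\<^bsup>2\<^esup> \<subseteq> F \<Longrightarrow> Q \<in> \<A>"
  shows "\<exists>V E p. partite k \<A> (V :: nat set) E p \<and>
    (\<forall>\<chi>. (\<forall>e \<in> E. \<chi> e < r) \<longrightarrow> (\<exists>\<psi>. \<forall>(W, F) \<in> set Ps. \<exists>h. inj_on h W \<and> h ` W \<subseteq> V \<and>
       (\<forall>e \<in> F. h ` e \<in> E \<and> \<chi> (h ` e) = \<psi> e)))"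
proof -
  define g :: "nat \<Rightarrow> 'w \<Rightarrow> nat" where "g l w = to_nat (l, w)" for l w
  define p :: "nat \<Rightarrow> 'w" where "p n = snd (from_nat n :: nat \<times> 'w)" for n
  have g_eq: "g l w = g l' w' \<longleftrightarrow> l = l' \<and> w = w'" for l l' w w' by (simp add: g_def)
  have pg: "p (g l w) = w" for l w by (simp add: g_def p_def)
  define V where "V = (\<Union>l < length Ps. g l ` fst (Ps ! l))"
  define E where "E = (\<Union>l < length Ps. (`) (g l) ` snd (Ps ! l))"
  have Pl: "finite (fst (Ps ! l))" "snd (Ps ! l) \<subseteq> [fst (Ps ! l)]\<^bsup>2\<^esup>" if "l < length Ps" for l
    using Ps[of "fst (Ps ! l)" "snd (Ps ! l)"] that by auto
  have P: "partite k \<A> V E p"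
    unfolding partite_def
  proof (intro conjI ballI allI impI)
    show "finite V" unfolding V_def using Pl(1) by blast
    show "E \<subseteq> [V]\<^bsup>2\<^esup>"
    proof
      fix e assume "e \<in> E"
      then obtain l f where l: "l < length Ps" "f \<in> snd (Ps ! l)" "e = g l ` f" unfolding E_def by blast
      have "f \<in> [fst (Ps ! l)]\<^bsup>2\<^esup>" using Pl(2) l(1,2) by blast
      then obtain x y where "f = {x, y}" "x \<in> fst (Ps ! l)" "y \<in> fst (Ps ! l)" "x \<noteq> y"
        by (elim nsets2_E) auto
      then show "e \<in> [V]\<^bsup>2\<^esup>" using l unfolding V_def by (auto simp: g_eq)
    qed
    show "inj_on p e" if "e \<in> E" for e
      using that unfolding E_def by (auto simp: pg intro!: inj_onI)
    fix Q assume Q: "Q \<subseteq> V" "card Q = k" "[Q]\<^bsup>2\<^esup> \<subseteq> E"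
    then have "Q \<noteq> {}" using k by auto
    then obtain q where q: "q \<in> Q" by blast
    then obtain l w where l: "l < length Ps" "w \<in> fst (Ps ! l)" "q = g l w"
      using Q(1) unfolding V_def by blast
    have edge: "\<exists>v. v \<in> fst (Ps ! l) \<and> q' = g l v \<and> {u, v} \<in> snd (Ps ! l)"
      if e: "{g l u, q'} \<in> E" for u q'
    proof -
      obtain l' f where f: "l' < length Ps" "f \<in> snd (Ps ! l')" "{g l u, q'} = g l' ` f"
        using e unfolding E_def by blast
      have "f \<in> [fst (Ps ! l')]\<^bsup>2\<^esup>" using Pl(2) f(1,2) by blast
      then obtain x y where xy: "f = {x, y}" "x \<in> fst (Ps ! l')" "y \<in> fst (Ps ! l')"
        by (elim nsets2_E) auto
      have "g l u = g l' x \<and> q' = g l' y \<or> g l u = g l' y \<and> q' = g l' x"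
        using f(3) xy(1) by (auto simp: doubleton_eq_iff)
      then show ?thesis using f(2) xy by (auto simp: g_eq insert_commute)
    qed
    define Q0 where "Q0 = {v \<in> fst (Ps ! l). g l v \<in> Q}"
    have "Q \<subseteq> g l ` fst (Ps ! l)"
    proof
      fix q' assume q': "q' \<in> Q"
      show "q' \<in> g l ` fst (Ps ! l)"
      proof (cases "q' = q")
        case False
        then have "{g l w, q'} \<in> E" using Q(3) q q' l(3) by auto
        then show ?thesis using edge by blast
      qed (use l in blast)
    qed
    then have im: "g l ` Q0 = Q" unfolding Q0_def by blast
    have "inj_on (g l) Q0" by (auto intro: inj_onI simp: g_eq)
    then have c0: "card Q0 = k" using im Q(2) card_image by metis
    have "[Q0]\<^bsup>2\<^esup> \<subseteq> snd (Ps ! l)"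
    proof
      fix e assume "e \<in> [Q0]\<^bsup>2\<^esup>"
      then obtain u v where e: "e = {u, v}" "u \<in> Q0" "v \<in> Q0" "u \<noteq> v" by (elim nsets2_E) auto
      then have "{g l u, g l v} \<in> [Q]\<^bsup>2\<^esup>" unfolding Q0_def by (auto simp: g_eq)
      then have "{g l u, g l v} \<in> E" using Q(3) by blast
      then show "e \<in> snd (Ps ! l)" using edge[of u "g l v"] e(1) by (auto simp: g_eq)
    qed
    moreover have Q0V: "Q0 \<subseteq> fst (Ps ! l)" unfolding Q0_def by blast
    moreover have "p ` Q = Q0" unfolding im[symmetric] image_image pg by simp
    ultimately show "p ` Q \<in> \<A>"
      using cl[of "fst (Ps ! l)" "snd (Ps ! l)" Q0] c0 l(1) Q0V by simp
  qed
  define Ds where "Ds = (`) p ` E"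
  have "finite E" using P finite_imp_finite_nsets[of V 2] by (auto simp: partite_def intro: finite_subset)
  then have finDs: "finite Ds" by (simp add: Ds_def)
  have Ds: "Ds \<subseteq> [UNIV]\<^bsup>2\<^esup>"
  proof
    fix D assume "D \<in> Ds"
    then obtain e where e: "e \<in> E" "D = p ` e" unfolding Ds_def by blast
    obtain x y where "e = {x, y}" "p x \<noteq> p y" using partite_edge[OF P e(1)] by metis
    then show "D \<in> [UNIV]\<^bsup>2\<^esup>" using e(2) by simp
  qed
  obtain V' E' p' where V': "partite k \<A> (V' :: nat set) E' p'"
    "\<And>\<chi>. (\<forall>e \<in> E'. \<chi> e < r) \<Longrightarrow> \<exists>h \<psi>. partite_copy V E p V' E' p' h \<and>
       (\<forall>e \<in> E. p ` e \<in> Ds \<longrightarrow> \<chi> (h ` e) = \<psi> (p ` e))"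
    using partite_iterate[OF finDs Ds P k r] by metis
  have "\<exists>\<psi>. \<forall>(W, F) \<in> set Ps. \<exists>h. inj_on h W \<and> h ` W \<subseteq> V' \<and>
       (\<forall>e \<in> F. h ` e \<in> E' \<and> \<chi> (h ` e) = \<psi> e)" if \<chi>: "\<forall>e \<in> E'. \<chi> e < r" for \<chi>
  proof -
    obtain h \<psi> where h: "partite_copy V E p V' E' p' h"
      "\<And>e. e \<in> E \<Longrightarrow> \<chi> (h ` e) = \<psi> (p ` e)"
      using V'(2)[OF \<chi>] unfolding Ds_def by blast
    have "\<exists>h. inj_on h W \<and> h ` W \<subseteq> V' \<and> (\<forall>e \<in> F. h ` e \<in> E' \<and> \<chi> (h ` e) = \<psi> e)"
      if "(W, F) \<in> set Ps" for W F
    proof -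
      obtain l where l: "l < length Ps" "Ps ! l = (W, F)" using \<open>(W, F) \<in> set Ps\<close> by (metis in_set_conv_nth)
      have gV: "g l ` W \<subseteq> V" using l unfolding V_def by force
      have gE: "g l ` e \<in> E" if "e \<in> F" for e using that l unfolding E_def by force
      have "inj_on (h \<circ> g l) W"
        using h(1) gV by (intro comp_inj_on) (auto simp: partite_copy_def g_eq intro: inj_on_subset inj_onI)
      moreover have "(h \<circ> g l) ` W \<subseteq> V'" using h(1) gV by (auto simp: partite_copy_def)
      moreover have "(h \<circ> g l) ` e \<in> E' \<and> \<chi> ((h \<circ> g l) ` e) = \<psi> e" if "e \<in> F" for e
      proof -
        have "p ` g l ` e = e" by (simp add: image_image pg)
        moreover have "(h \<circ> g l) ` e = h ` g l ` e" by (simp add: image_comp)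
        ultimately show ?thesis using h(2)[OF gE[OF that]] gE[OF that] h(1) by (simp add: partite_copy_def)
      qed
      ultimately show ?thesis by blast
    qed
    then show ?thesis by blast
  qed
  then show ?thesis using V'(1) by blast
qed

section \<open>Forcing a colour pattern on pairs\<close>

definition mono_set :: "('a set \<Rightarrow> nat) \<Rightarrow> 'a set \<Rightarrow> nat \<Rightarrow> bool" where
  "mono_set \<psi> Q c \<longleftrightarrow> (\<forall>e \<in> [Q]\<^bsup>2\<^esup>. \<psi> e = c)"

lemma mono_setI: "(\<And>x y. x \<in> Q \<Longrightarrow> y \<in> Q \<Longrightarrow> x \<noteq> y \<Longrightarrow> \<psi> {x, y} = c) \<Longrightarrow> mono_set \<psi> Q c"
  unfolding mono_set_def by (metis nsets2_E)

lemma mono_setD: "mono_set \<psi> Q c \<Longrightarrow> x \<in> Q \<Longrightarrow> y \<in> Q \<Longrightarrow> x \<noteq> y \<Longrightarrow> \<psi> {x, y} = c"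
  by (auto simp: mono_set_def)

text \<open>The family \<open>\<K>\<close> is minimal among the families of \<open>k\<close>-sets that meet the Ramsey property;
  \<open>\<theta>\<close> is a colouring witnessing that \<open>K0\<close> cannot be dropped.\<close>
lemma critical_system:
  fixes k r :: nat
  assumes k: "k \<ge> 2" and r: "r > 0"
  obtains N :: nat and \<K> :: "nat set set" and K0 where
    "\<And>L. L \<in> \<K> \<Longrightarrow> L \<subseteq> {..<N} \<and> card L = k" "K0 \<in> \<K>"
    "\<And>\<psi>. (\<forall>e \<in> [{..<N}]\<^bsup>2\<^esup>. \<psi> e < r) \<Longrightarrow> \<exists>L \<in> \<K>. \<exists>c. mono_set \<psi> L c"
    "\<And>c. c < r \<Longrightarrow> \<exists>\<theta>. (\<forall>e \<in> [{..<N}]\<^bsup>2\<^esup>. \<theta> e < r) \<and> mono_set \<theta> K0 c \<and>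
       (\<forall>L \<in> \<K>. \<forall>d. mono_set \<theta> L d \<longrightarrow> L = K0)"
proof -
  obtain N :: nat where N: "partn_lst {..<N} (replicate r k) 2" using ramsey_full by blast
  define ram where "ram \<K> \<longleftrightarrow> (\<forall>\<psi>. (\<forall>e \<in> [{..<N}]\<^bsup>2\<^esup>. \<psi> e < r) \<longrightarrow> (\<exists>L \<in> \<K>. \<exists>c. mono_set \<psi> L c))"
    for \<K> :: "nat set set"
  have "ram ([{..<N}]\<^bsup>k\<^esup>)"
    unfolding ram_def
  proof (intro allI impI)
    fix \<psi> :: "nat set \<Rightarrow> nat"
    assume "\<forall>e \<in> [{..<N}]\<^bsup>2\<^esup>. \<psi> e < r"
    then have "\<psi> \<in> [{..<N}]\<^bsup>2\<^esup> \<rightarrow> {..<r}" by auto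
    then obtain i H where "i < r" "H \<in> [{..<N}]\<^bsup>(replicate r k ! i)\<^esup>" "\<psi> ` [H]\<^bsup>2\<^esup> \<subseteq> {i}"
      using partn_lstE[OF N, of \<psi> r] by (metis length_replicate)
    then have "H \<in> [{..<N}]\<^bsup>k\<^esup>" "\<psi> ` [H]\<^bsup>2\<^esup> \<subseteq> {i}" by auto
    then show "\<exists>L \<in> [{..<N}]\<^bsup>k\<^esup>. \<exists>c. mono_set \<psi> L c" unfolding mono_set_def by blast
  qed
  moreover have "finite {\<K>. \<K> \<subseteq> [{..<N}]\<^bsup>k\<^esup> \<and> ram \<K>}"
    by (rule finite_subset[of _ "Pow ([{..<N}]\<^bsup>k\<^esup>)"]) (auto simp: finite_imp_finite_nsets)
  ultimately obtain \<K> where \<K>: "\<K> \<subseteq> [{..<N}]\<^bsup>k\<^esup>" "ram \<K>"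
    "\<And>\<K>'. \<K>' \<subseteq> [{..<N}]\<^bsup>k\<^esup> \<Longrightarrow> ram \<K>' \<Longrightarrow> \<K>' \<subseteq> \<K> \<Longrightarrow> \<K> = \<K>'"
    using finite_has_minimal2[of "{\<K>. \<K> \<subseteq> [{..<N}]\<^bsup>k\<^esup> \<and> ram \<K>}" "[{..<N}]\<^bsup>k\<^esup>"] by auto
  \<comment> \<open>A constant colouring shows that \<open>\<K>\<close> is not empty.\<close>
  have "\<exists>L \<in> \<K>. \<exists>c. mono_set (\<lambda>_. 0) L c"
    using \<K>(2)[unfolded ram_def, rule_format, of "\<lambda>_. 0"] r by simp
  then obtain K0 where K0: "K0 \<in> \<K>" by blast
  have "\<not> ram (\<K> - {K0})" using \<K>(1) \<K>(3)[of "\<K> - {K0}"] K0 by blast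
  then obtain \<theta> where \<theta>: "\<forall>e \<in> [{..<N}]\<^bsup>2\<^esup>. \<theta> e < r" "\<And>L c. L \<in> \<K> \<Longrightarrow> L \<noteq> K0 \<Longrightarrow> \<not> mono_set \<theta> L c"
    unfolding ram_def by blast
  then obtain c0 where c0: "mono_set \<theta> K0 c0" using \<K>(2) unfolding ram_def by metis
  have K0': "K0 \<subseteq> {..<N}" "card K0 = k" using \<K>(1) K0 by (auto simp: nsets_def)
  \<comment> \<open>\<open>K0\<close> contains a pair because \<open>k \<ge> 2\<close>, so its
    colour \<open>c0\<close> is attained and lies below \<open>r\<close>.\<close>
  have "[K0]\<^bsup>2\<^esup> \<noteq> {}" using K0' k by (auto simp: nsets_eq_empty_iff finite_subset)
  then obtain e where e: "e \<in> [K0]\<^bsup>2\<^esup>" by blast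
  then have "e \<in> [{..<N}]\<^bsup>2\<^esup>" using nsets_mono[OF K0'(1)] by blast
  then have c0r: "c0 < r" using \<theta>(1) c0 e unfolding mono_set_def by metis
  have "\<exists>\<theta>. (\<forall>e \<in> [{..<N}]\<^bsup>2\<^esup>. \<theta> e < r) \<and> mono_set \<theta> K0 c \<and>
       (\<forall>L \<in> \<K>. \<forall>d. mono_set \<theta> L d \<longrightarrow> L = K0)" if c: "c < r" for c
  proof -
    \<comment> \<open>Exchanging \<open>c0\<close> and \<open>c\<close> prescribes the colour of
      \<open>K0\<close>.\<close>
    define \<sigma> where "\<sigma> x = (if x = c0 then c else if x = c then c0 else x)" for x
    have \<sigma>2: "\<sigma> (\<sigma> x) = x" for x by (simp add: \<sigma>_def)
    have "mono_set \<theta> L (\<sigma> d)" if "mono_set (\<sigma> \<circ> \<theta>) L d" for L d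
      using that \<sigma>2 unfolding mono_set_def by (metis comp_apply)
    then have "\<forall>L \<in> \<K>. \<forall>d. mono_set (\<sigma> \<circ> \<theta>) L d \<longrightarrow> L = K0" using \<theta>(2) by blast
    moreover have "mono_set (\<sigma> \<circ> \<theta>) K0 c" using c0 by (simp add: mono_set_def \<sigma>_def)
    moreover have "\<forall>e \<in> [{..<N}]\<^bsup>2\<^esup>. (\<sigma> \<circ> \<theta>) e < r" using \<theta>(1) c c0r by (simp add: \<sigma>_def)
    ultimately show ?thesis by blast
  qed
  moreover have "L \<subseteq> {..<N} \<and> card L = k" if "L \<in> \<K>" for L using that \<K>(1) by (auto simp: nsets_def)
  ultimately show thesis using that[of \<K> N K0] K0 \<K>(2) unfolding ram_def by blast
qed

type_synonym hub = "nat + nat \<times> nat"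
text \<open>\<open>Inr (T, j)\<close> is the fresh vertex \<open>j\<close> of the critical system
  attached to the triangle \<open>T\<close>.\<close>

type_synonym ext = "hub + (hub \<times> hub \<times> hub) \<times> nat"

text \<open>Besides \<open>B\<close> there are hub vertices \<open>Inr (i, l)\<close>, joined in colour \<open>i\<close> to \<open>B\<close> and to each other;
  they transport the colour of an edge of \<open>B\<close> to any other edge with the same \<open>\<psi>B\<close>-colour. A fresh copy
  of a critical system, glued along three vertices of \<open>K0\<close>, is attached to each monochromatic triangle
  and forces it to stay monochromatic.\<close>
lemma forcing_extension:
  fixes k r :: nat and B :: "nat set" and \<psi>B :: "nat set \<Rightarrow> nat"
  assumes k: "k \<ge> 3" and r: "r > 0" and B: "finite B" and \<psi>B: "\<And>e. e \<in> [B]\<^bsup>2\<^esup> \<Longrightarrow> \<psi>B e < r"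
  obtains W :: "ext set" and \<psi>0 and \<iota> where
    "finite W" "inj \<iota>" "\<iota> ` B \<subseteq> W" "\<And>e. \<psi>0 e < r" "\<And>e. e \<in> [B]\<^bsup>2\<^esup> \<Longrightarrow> \<psi>0 (\<iota> ` e) = \<psi>B e"
    "\<And>\<psi>. (\<And>e. e \<in> [W]\<^bsup>2\<^esup> \<Longrightarrow> \<psi> e < r) \<Longrightarrow>
       (\<And>Q c. Q \<subseteq> W \<Longrightarrow> card Q = k \<Longrightarrow> mono_set \<psi> Q c \<Longrightarrow> \<exists>d. mono_set \<psi>0 Q d) \<Longrightarrow>
       \<exists>\<pi>. inj_on \<pi> (\<psi>B ` [B]\<^bsup>2\<^esup>) \<and> (\<forall>e \<in> [B]\<^bsup>2\<^esup>. \<psi> (\<iota> ` e) = \<pi> (\<psi>B e))"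
proof -
  have k2: "k \<ge> 2" using k by simp
  obtain N :: nat and \<K> K0 where
    \<K>: "\<And>L. L \<in> \<K> \<Longrightarrow> L \<subseteq> {..<N} \<and> card L = k" "K0 \<in> \<K>"
    and ram: "\<And>\<psi>. (\<forall>e \<in> [{..<N}]\<^bsup>2\<^esup>. \<psi> e < r) \<Longrightarrow> \<exists>L \<in> \<K>. \<exists>c. mono_set \<psi> L c"
    and ex\<theta>: "\<And>c. c < r \<Longrightarrow> \<exists>\<theta>. (\<forall>e \<in> [{..<N}]\<^bsup>2\<^esup>. \<theta> e < r) \<and> mono_set \<theta> K0 c \<and>
       (\<forall>L \<in> \<K>. \<forall>d. mono_set \<theta> L d \<longrightarrow> L = K0)"
    by (rule critical_system[OF k2 r]) blast
  obtain \<theta> where \<theta>: "\<And>c e. c < r \<Longrightarrow> e \<in> [{..<N}]\<^bsup>2\<^esup> \<Longrightarrow> \<theta> c e < r"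
    "\<And>c. c < r \<Longrightarrow> mono_set (\<theta> c) K0 c"
    "\<And>c L d. c < r \<Longrightarrow> L \<in> \<K> \<Longrightarrow> mono_set (\<theta> c) L d \<Longrightarrow> L = K0"
    using ex\<theta> by metis
  obtain Z where Z: "Z \<subseteq> K0" "card Z = 3" using \<K> k by (metis obtain_subset_with_card_n)
  then obtain z0 z1 z2 where z: "z0 \<in> K0" "z1 \<in> K0" "z2 \<in> K0" "z0 \<noteq> z1" "z0 \<noteq> z2" "z1 \<noteq> z2"
    by (auto simp: card_3_iff)
  have K0N: "K0 \<subseteq> {..<N}" using \<K> by blast
  define U :: "hub set" where "U = Inl ` B \<union> Inr ` ({..<r} \<times> {..<k})"
  have finU: "finite U" using B by (simp add: U_def)
  \<comment> \<open>A pair with one hub vertex gets the index of this hub. \<open>Max\<close> is an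
    arbitrary choice when two hubs have different indices.\<close>
  define \<psi>U where "\<psi>U e = (if Inr -` e = {} then \<psi>B (Inl -` e) else Max (fst ` (Inr -` e)))" for e :: "hub set"
  \<comment> \<open>The triples are ordered, so that they say which vertices take the places of
    \<open>z0\<close>, \<open>z1\<close> and \<open>z2\<close>.\<close>
  define Ts where "Ts = {(t0, t1, t2). t0 \<in> U \<and> t1 \<in> U \<and> t2 \<in> U \<and> t0 \<noteq> t1 \<and> t0 \<noteq> t2 \<and> t1 \<noteq> t2 \<and>
     \<psi>U {t0, t1} = \<psi>U {t0, t2} \<and> \<psi>U {t0, t1} = \<psi>U {t1, t2}}"
  have finTs: "finite Ts" by (rule finite_subset[of _ "U \<times> U \<times> U"]) (auto simp: Ts_def finU)
  define W :: "ext set" where "W = Inl ` U \<union> Inr ` (Ts \<times> {..<N})"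
  define g :: "hub \<times> hub \<times> hub \<Rightarrow> nat \<Rightarrow> ext" where
    "g T j = (case T of (t0, t1, t2) \<Rightarrow> if j = z0 then Inl t0 else if j = z1 then Inl t1
       else if j = z2 then Inl t2 else Inr (T, j))" for T j
  define tcol where "tcol T = (case T of (t0, t1, t2) \<Rightarrow> \<psi>U {t0, t1})"
    for T :: "hub \<times> hub \<times> hub"
  \<comment> \<open>A pair with a fresh vertex lies in at most one attached system, so
    \<open>SOME\<close> finds the right \<open>T\<close>. For pairs in none the value is
    unspecified, and \<open>\<psi>0\<close> replaces it by 0 if it is not below
    \<open>r\<close>.\<close>
  define raw where "raw e = (if Inr -` e = {} then \<psi>U (Inl -` e)
     else (let T = (SOME T. T \<in> Ts \<and> e \<subseteq> g T ` {..<N}) in \<theta> (tcol T) {j. j < N \<and> g T j \<in> e}))" for e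
  define \<psi>0 where "\<psi>0 e = (if raw e < r then raw e else 0)" for e
  define \<iota> :: "nat \<Rightarrow> ext" where "\<iota> b = Inl (Inl b)" for b
  have vim: "Inl -` {Inl a, Inl b} = {a, b}" "Inr -` {Inl a, Inl b} = {}" "Inr -` {Inr x, Inr y} = {x, y}"
    "Inr -` {Inr x, Inl a} = {x}" "Inr -` {Inl a, Inr x} = {x}"
    for a b :: 'p and x y :: 'q
    by auto
  have \<psi>U_B: "\<psi>U {Inl a, Inl b} = \<psi>B {a, b}" for a b by (simp add: \<psi>U_def vim)
  have \<psi>U_H: "\<psi>U {Inl a, Inr (i, l)} = i" "\<psi>U {Inr (i, l), Inl a} = i" "\<psi>U {Inr (i, l), Inr (i, l')} = i"
    for a i l l' by (simp_all add: \<psi>U_def vim)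
  have \<psi>U_less: "\<psi>U {u, v} < r" if "u \<in> U" "v \<in> U" "u \<noteq> v" for u v
    using that \<psi>B[of "{x, y}" for x y] unfolding U_def by (auto simp: \<psi>U_def vim)
  have \<psi>0_U: "\<psi>0 {Inl u, Inl v} = \<psi>U {u, v}" if "u \<in> U" "v \<in> U" "u \<noteq> v" for u v
    using \<psi>U_less[OF that] by (simp add: \<psi>0_def raw_def vim)
  have tcol_less: "tcol T < r" if "T \<in> Ts" for T
    using that \<psi>U_less by (auto simp: Ts_def tcol_def)
  have gW: "g T j \<in> W" if "T \<in> Ts" "j < N" for T j
    using that by (auto simp: Ts_def W_def g_def)
  have g_inj: "g T i = g T j \<longleftrightarrow> i = j" if "T \<in> Ts" for T i j
    using that by (auto simp: Ts_def g_def split: if_splits)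
  have g_Inr: "T' = T \<and> i \<notin> {z0, z1, z2}" if "g T i = Inr (T', j)" for T T' i j
    using that by (auto simp: g_def split: if_splits prod.splits)
  have g_Inl: "i \<in> {z0, z1, z2}" if "g T i = Inl u" for T i u
    using that by (auto simp: g_def split: if_splits prod.splits)
  have g_col: "\<psi>0 {g T i, g T j} = \<theta> (tcol T) {i, j}" if T: "T \<in> Ts" and ij: "i < N" "j < N" "i \<noteq> j" for T i j
  proof -
    have less: "\<theta> (tcol T) {i, j} < r" using \<theta>(1)[OF tcol_less[OF T], of "{i, j}"] ij by simp
    show ?thesis
    proof (cases "Inr -` {g T i, g T j} = {}")
      case True
      then have "\<exists>u. g T i = Inl u" "\<exists>u. g T j = Inl u" by (metis sum.exhaust vimageI2 insertI1 insertI2 empty_iff)+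
      then have in_z: "i \<in> {z0, z1, z2}" "j \<in> {z0, z1, z2}" using g_Inl by metis+
      then have "i \<in> K0" "j \<in> K0" using z by auto
      then have "\<theta> (tcol T) {i, j} = tcol T"
        using mono_setD[OF \<theta>(2)[OF tcol_less[OF T]]] ij by blast
      moreover have "\<psi>0 {g T i, g T j} = tcol T"
      proof -
        obtain t0 t1 t2 where t: "T = (t0, t1, t2)" by (cases T)
        note Ts = T[unfolded t Ts_def, simplified]
        have "\<psi>0 {Inl t0, Inl t1} = tcol T" "\<psi>0 {Inl t0, Inl t2} = tcol T" "\<psi>0 {Inl t1, Inl t2} = tcol T"
          using Ts by (simp_all add: \<psi>0_U tcol_def t)
        then show ?thesis using in_z ij z by (auto simp: g_def t insert_commute)
      qed
      ultimately show ?thesis by simp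
    next
      case False
      then obtain T' l where "Inr (T', l) \<in> {g T i, g T j}" by auto
      then have T'l: "Inr (T, l) \<in> {g T i, g T j}" using g_Inr by (metis empty_iff insert_iff)

      have "(SOME T''. T'' \<in> Ts \<and> {g T i, g T j} \<subseteq> g T'' ` {..<N}) = T"
      proof (rule some_equality)
        show "T \<in> Ts \<and> {g T i, g T j} \<subseteq> g T ` {..<N}" using T ij by auto
        fix T'' assume "T'' \<in> Ts \<and> {g T i, g T j} \<subseteq> g T'' ` {..<N}"
        then have "Inr (T, l) \<in> g T'' ` {..<N}" using T'l by blast
        then show "T'' = T" using g_Inr by (metis imageE)
      qed
      moreover have "{l. l < N \<and> g T l \<in> {g T i, g T j}} = {i, j}"
        using ij g_inj[OF T] by auto
      ultimately have "raw {g T i, g T j} = \<theta> (tcol T) {i, j}"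
        using False by (simp add: raw_def)
      then show ?thesis using less by (simp add: \<psi>0_def)
    qed
  qed
  have forced: "\<exists>\<pi>. inj_on \<pi> (\<psi>B ` [B]\<^bsup>2\<^esup>) \<and> (\<forall>e \<in> [B]\<^bsup>2\<^esup>. \<psi> (\<iota> ` e) = \<pi> (\<psi>B e))"
    if \<psi>: "\<And>e. e \<in> [W]\<^bsup>2\<^esup> \<Longrightarrow> \<psi> e < r"
      and mono: "\<And>Q c. Q \<subseteq> W \<Longrightarrow> card Q = k \<Longrightarrow> mono_set \<psi> Q c \<Longrightarrow> \<exists>d. mono_set \<psi>0 Q d" for \<psi>
  proof -
    define \<Psi> where "\<Psi> u v = \<psi> {Inl u, Inl v}" for u v
    have \<Psi>_commute: "\<Psi> u v = \<Psi> v u" for u v by (simp add: \<Psi>_def insert_commute)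
    \<comment> \<open>The pullback of \<open>\<psi>\<close> to the attached system is monochromatic
      on some member \<open>L\<close>. Then \<open>\<psi>0\<close> is monochromatic on the image of
      \<open>L\<close>, so the critical colouring is monochromatic on \<open>L\<close>, which leaves
      \<open>L = K0\<close>.\<close>
    have tri: "\<Psi> u v = \<Psi> u w \<and> \<Psi> u v = \<Psi> v w"
      if T: "(u, v, w) \<in> Ts" for u v w
    proof -
      let ?g = "g (u, v, w)"
      have "\<forall>e \<in> [{..<N}]\<^bsup>2\<^esup>. \<psi> (?g ` e) < r"
      proof
        fix e assume "e \<in> [{..<N}]\<^bsup>2\<^esup>"
        then obtain i j where "e = {i, j}" "i < N" "j < N" "i \<noteq> j" by (elim nsets2_E) auto
        then show "\<psi> (?g ` e) < r" using \<psi>[of "?g ` e"] gW[OF T] g_inj[OF T] by simp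
      qed
      then obtain L c where L: "L \<in> \<K>" "mono_set (\<lambda>e. \<psi> (?g ` e)) L c" using ram by metis
      have LN: "L \<subseteq> {..<N}" "card L = k" using \<K>(1)[OF L(1)] by auto
      have ginj: "inj_on ?g I" for I using g_inj[OF T] by (auto intro: inj_onI)
      have "mono_set \<psi> (?g ` L) c"
        using mono_setD[OF L(2)] by (intro mono_setI) auto
      moreover have "?g ` L \<subseteq> W" using gW[OF T] LN by auto
      moreover have "card (?g ` L) = k" using LN(2) card_image[OF ginj] by metis
      ultimately obtain d where d: "mono_set \<psi>0 (?g ` L) d" using mono by blast
      have "mono_set (\<theta> (tcol (u, v, w))) L d"
      proof (rule mono_setI)
        fix i j assume ij: "i \<in> L" "j \<in> L" "i \<noteq> j"
        then have "\<psi>0 {?g i, ?g j} = d" using mono_setD[OF d] g_inj[OF T] by blast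
        moreover have "i < N" "j < N" using ij LN by auto
        ultimately show "\<theta> (tcol (u, v, w)) {i, j} = d" using g_col[OF T] ij(3) by metis
      qed
      then have "L = K0" using \<theta>(3)[OF tcol_less[OF T] L(1)] by blast
      then have m: "mono_set (\<lambda>e. \<psi> (?g ` e)) K0 c" using L(2) by simp
      show ?thesis
        using mono_setD[OF m, of z0 z1] mono_setD[OF m, of z0 z2] mono_setD[OF m, of z1 z2] z
        by (simp add: g_def \<Psi>_def insert_commute)
    qed
    define H :: "nat \<Rightarrow> nat \<Rightarrow> hub" where "H i l = Inr (i, l)" for i l
    \<comment> \<open>The colour under \<open>\<psi>\<close> of one pair of hubs of index
      \<open>i\<close>. Triangles carry it first to the pairs between \<open>B\<close> and these
      hubs, then to the pairs of \<open>B\<close> coloured \<open>i\<close>.\<close>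
    define \<pi> where "\<pi> i = \<Psi> (H i 0) (H i 1)" for i
    have HU: "H i l \<in> U" if "i < r" "l < k" for i l using that by (simp add: H_def U_def)
    have BU: "Inl b \<in> U" if "b \<in> B" for b using that by (simp add: U_def)
    have BHH: "(Inl b, H i l, H i l') \<in> Ts" if "b \<in> B" "i < r" "l < k" "l' < k" "l \<noteq> l'" for b i l l'
      using that HU BU unfolding Ts_def by (simp add: H_def \<psi>U_H)
    have BBH: "(Inl a, Inl b, H (\<psi>B {a, b}) l) \<in> Ts" if "a \<in> B" "b \<in> B" "a \<noteq> b" "l < k" for a b l
      using that HU BU \<psi>B[of "{a, b}"] unfolding Ts_def by (simp add: H_def \<psi>U_H \<psi>U_B)
    have bH0: "\<Psi> (Inl b) (H i 0) = \<pi> i" if "b \<in> B" "i < r" for b i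
      using tri[OF BHH[of b i 0 1]] that k by (simp add: \<pi>_def)
    have bH: "\<Psi> (Inl b) (H i l) = \<pi> i" if "b \<in> B" "i < r" "l < k" for b i l
      using tri[OF BHH[of b i 0 l]] bH0[of b i] that k by (cases "l = 0") auto
    have HH: "\<Psi> (H i l) (H i l') = \<pi> i" if "b \<in> B" "i < r" "l < k" "l' < k" "l \<noteq> l'" for b i l l'
      using tri[OF BHH[of b i l l']] bH[of b i l] that by simp
    have ab: "\<Psi> (Inl a) (Inl b) = \<pi> (\<psi>B {a, b})" if "a \<in> B" "b \<in> B" "a \<noteq> b" for a b
      using tri[OF BBH[of a b 0]] bH[of a "\<psi>B {a, b}" 0] \<psi>B[of "{a, b}"] that k by simp
    have inj: "\<pi> (\<psi>B {a, b}) \<noteq> \<pi> j" if "a \<in> B" "b \<in> B" "a \<noteq> b" "j < r" "j \<noteq> \<psi>B {a, b}" for a b j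
    proof
      assume eq: "\<pi> (\<psi>B {a, b}) = \<pi> j"
      \<comment> \<open>If two values of \<open>\<pi>\<close> agree, then \<open>a\<close>,
        \<open>b\<close> and \<open>k - 2\<close> hubs of index \<open>j\<close> form a
        monochromatic set for \<open>\<psi>\<close>. Under \<open>\<psi>0\<close>, however, the pair
        of \<open>a\<close> and \<open>b\<close> differs in colour from the pair of \<open>a\<close>
        and a hub.\<close>
      define Q where "Q = {Inl a, Inl b} \<union> H j ` {..<k - 2}"
      have "inj_on (H j) {..<k - 2}" by (auto simp: H_def intro: inj_onI)
      then have "card (H j ` {..<k - 2}) = k - 2" by (simp add: card_image)
      moreover have "{Inl a, Inl b} \<inter> H j ` {..<k - 2} = {}" by (auto simp: H_def)
      ultimately have "card Q = k" unfolding Q_def using that(3) k by (subst card_Un_disjoint) auto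
      then have cQ: "card (Inl ` Q :: ext set) = k" by (simp add: card_image)
      have QU: "Q \<subseteq> U" using HU BU that unfolding Q_def by auto
      have HH': "\<Psi> u v = \<pi> j" if uv: "u \<in> H j ` {..<k - 2}" "v \<in> H j ` {..<k - 2}" "u \<noteq> v" for u v
      proof -
        obtain l l' where "u = H j l" "v = H j l'" "l < k" "l' < k" using uv(1,2) by auto
        then show ?thesis using HH[OF \<open>a \<in> B\<close> \<open>j < r\<close>, of l l'] uv(3) by blast
      qed
      have "\<Psi> u v = \<pi> j" if "u \<in> Q" "v \<in> Q" "u \<noteq> v" for u v
        using that bH[of a j] bH[of b j] HH' ab[of a b] \<open>a \<in> B\<close> \<open>b \<in> B\<close> \<open>a \<noteq> b\<close> \<open>j < r\<close> eq \<Psi>_commute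
        unfolding Q_def by (auto 0 3)
      then have "mono_set \<psi> (Inl ` Q) (\<pi> j)" by (intro mono_setI) (auto simp: \<Psi>_def)
      then obtain d where d: "mono_set \<psi>0 (Inl ` Q) d"
        using mono[of "Inl ` Q"] cQ QU unfolding W_def by blast
      have H0: "H j 0 \<in> Q" using k unfolding Q_def by auto
      have "\<psi>0 {Inl (Inl a), Inl (Inl b)} = d" "\<psi>0 {Inl (Inl a), Inl (H j 0)} = d"
        using mono_setD[OF d] H0 that(3) unfolding Q_def by (auto simp: H_def)
      then show False
        using \<psi>0_U[of "Inl a" "Inl b"] \<psi>0_U[of "Inl a" "H j 0"] that HU[of j 0] BU k
        by (simp add: \<psi>U_B H_def \<psi>U_H)
    qed
    have "inj_on \<pi> (\<psi>B ` [B]\<^bsup>2\<^esup>)"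
    proof (rule inj_onI, rule ccontr)
      fix i j assume ij: "i \<in> \<psi>B ` [B]\<^bsup>2\<^esup>" "j \<in> \<psi>B ` [B]\<^bsup>2\<^esup>" "\<pi> i = \<pi> j" "i \<noteq> j"
      then obtain e f where "e \<in> [B]\<^bsup>2\<^esup>" "i = \<psi>B e" "f \<in> [B]\<^bsup>2\<^esup>" "j = \<psi>B f" by blast
      moreover then obtain a b where "e = {a, b}" "a \<in> B" "b \<in> B" "a \<noteq> b" by (elim nsets2_E) auto
      ultimately show False using inj[of a b j] \<psi>B[of f] ij by auto
    qed
    moreover have "\<psi> (\<iota> ` e) = \<pi> (\<psi>B e)" if "e \<in> [B]\<^bsup>2\<^esup>" for e
      using that ab by (auto elim!: nsets2_E simp: \<iota>_def \<Psi>_def)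
    ultimately show ?thesis by blast
  qed
  show thesis
  proof (rule that)
    show "finite W" using finU finTs by (simp add: W_def)
    show "inj \<iota>" by (auto simp: \<iota>_def intro: injI)
    show "\<iota> ` B \<subseteq> W" by (auto simp: \<iota>_def W_def U_def)
    show "\<psi>0 e < r" for e using r by (simp add: \<psi>0_def)
    show "\<psi>0 (\<iota> ` e) = \<psi>B e" if "e \<in> [B]\<^bsup>2\<^esup>" for e
      using that \<psi>0_U by (auto elim!: nsets2_E simp: \<iota>_def U_def \<psi>U_B)
  qed (rule forced)
qed

section \<open>Finite fields of characteristic two\<close>

lemma char2: "(x :: bit alg_closure) + x = 0"
proof -
  have "(1 :: bit alg_closure) + 1 = to_ac (1 + 1)" by (simp only: to_ac_add to_ac_1)
  also have "\<dots> = 0" by simp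
  finally show ?thesis by (metis mult_2 mult_zero_left one_add_one)
qed

text \<open>For \<open>j > 0\<close> this is the subfield with \<open>2 ^ j\<close> elements inside
  the algebraic closure of the field with two elements.\<close>

definition frob_fixed :: "nat \<Rightarrow> bit alg_closure set" where
  "frob_fixed j = {x. x ^ (2 ^ j) = x}"

lemma frob_add: "((x :: bit alg_closure) + y) ^ (2 ^ j) = x ^ (2 ^ j) + y ^ (2 ^ j)"
proof (induction j)
  case (Suc j)
  have sq: "(a + b) ^ 2 = a ^ 2 + b ^ 2" for a b :: "bit alg_closure"
    using char2[of "a * b"] by (simp add: power2_eq_square algebra_simps)
  have "(x + y) ^ (2 ^ Suc j) = ((x + y) ^ (2 ^ j)) ^ 2"
    by (simp add: power_mult[symmetric] mult.commute)
  also have "\<dots> = (x ^ (2 ^ j)) ^ 2 + (y ^ (2 ^ j)) ^ 2" using Suc sq by simp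
  finally show ?case by (simp add: power_mult[symmetric] mult.commute)
qed auto

lemma frob_fixed_closed:
  assumes "x \<in> frob_fixed j" "y \<in> frob_fixed j"
  shows "x + y \<in> frob_fixed j" "x - y \<in> frob_fixed j" "x * y \<in> frob_fixed j"
proof -
  have "x - y = x + y" by (simp add: diff_eq_eq add.assoc char2)
  moreover show "x + y \<in> frob_fixed j" "x * y \<in> frob_fixed j"
    using assms by (auto simp: frob_fixed_def frob_add power_mult_distrib)
  ultimately show "x - y \<in> frob_fixed j" by (simp only:)
qed

text \<open>With q = 2^j, the polynomial X^q - X splits over the closure, and its derivative is -1
  because q vanishes in characteristic two. So it has q distinct roots.\<close>

lemma card_frob_fixed:
  assumes "j > 0"
  shows "card (frob_fixed j) = 2 ^ j"
proof -
  let ?q = "2 ^ j :: nat"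
  define p :: "bit alg_closure poly" where "p = monom 1 ?q - monom 1 1"
  have q: "?q \<ge> 2" using assms by (metis one_le_numeral power_increasing power_one_right Suc_leI One_nat_def)
  have p0: "p \<noteq> 0"
  proof
    assume "p = 0"
    then have "coeff p ?q = 0" by simp
    then show False using q by (simp add: p_def)
  qed
  have "Polynomial.degree (- monom (1 :: bit alg_closure) 1) < Polynomial.degree (monom (1 :: bit alg_closure) ?q)"
    using q by (simp add: degree_monom_eq)
  then have deg: "Polynomial.degree p = ?q"
    unfolding p_def diff_conv_add_uminus by (subst degree_add_eq_left) (auto simp: degree_monom_eq)
  have ev: "poly p x = x ^ ?q - x" for x by (simp add: p_def poly_monom)
  have two: "(2 :: bit alg_closure) = 0"
    using char2[of 1] by (simp only: one_add_one)
  have "(of_nat ?q :: bit alg_closure) = 2 ^ j" by simp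
  also have "\<dots> = 0" unfolding two using assms by simp
  finally have "(of_nat ?q :: bit alg_closure) = 0" .
  moreover have "pderiv p = monom (of_nat ?q) (?q - 1) - monom (of_nat 1) (1 - 1)"
    unfolding p_def pderiv_diff pderiv_monom by simp
  ultimately have pd: "pderiv p = - 1" by (simp only: monom_eq_0) (simp add: monom_0 one_pCons)
  have le: "order a p \<le> 1" for a
  proof (rule ccontr)
    assume "\<not> ?thesis"
    then have "[:-a, 1:] ^ 2 dvd p" by (intro order_divides[THEN iffD2]) auto
    then obtain u where "p = [:-a, 1:] * ([:-a, 1:] * u)"
      unfolding power2_eq_square dvd_def by (metis mult.assoc)
    then have "poly (pderiv p) a = 0" by (simp add: pderiv_mult del: mult_pCons_left)
    then show False unfolding pd by simp
  qed
  obtain A where A: "size A = Polynomial.degree p" "p = smult (lead_coeff p) (\<Prod>x\<in>#A. [:-x, 1:])"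
    using alg_closed_imp_factorization[OF p0] by blast
  have "proots p = proots (\<Prod>x\<in>#A. [:-x, 1:])"
    using p0 by (subst A(2)) simp
  also have "\<dots> = A"
  proof (induction A)
    case (add a A)
    have "(\<Prod>x\<in>#A. [:-x, 1:]) \<noteq> 0" by (auto simp: prod_mset_zero_iff)
    then show ?case using add.IH
      by (simp add: proots_mult proots_linear_factor del: mult_pCons_left)
  qed simp
  finally have pA: "proots p = A" .
  have "set_mset A = frob_fixed j"
    unfolding pA[symmetric] using p0 by (auto simp: ev frob_fixed_def)
  moreover have "A = mset_set (set_mset A)"
  proof (rule multiset_eqI)
    fix a
    show "count A a = count (mset_set (set_mset A)) a"
    proof (cases "a \<in># A")
      case True
      moreover have "count A a = order a p" using p0 pA count_proots[of p a] by simp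
      ultimately have "count A a = 1" using le[of a] count_eq_zero_iff[of A a] by linarith
      then show ?thesis using True by simp
    qed (simp add: not_in_iff)
  qed
  ultimately show ?thesis using A(1) deg by (metis size_mset_set)
qed

section \<open>Labelling lines\<close>

text \<open>By Bernoulli's inequality, with \<open>m = a + 1\<close>, the right side is at least
  \<open>a ^ m + m * a ^ (m - 1)\<close>, and the second summand exceeds the first.\<close>

lemma two_mult_pred_power_less:
  fixes m :: nat
  assumes "m \<ge> 2"
  shows "2 * (m - 1) ^ m < m ^ m"
proof -
  obtain a where a: "m = Suc a" "a > 0" using assms by (cases m) auto
  have bern: "(a + 1) ^ b \<ge> a ^ b + b * a ^ (b - 1)" for b
  proof (induction b)
    case (Suc b)
    have "(a + 1) ^ Suc b \<ge> (a + 1) * (a ^ b + b * a ^ (b - 1))"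
      using mult_le_mono2[OF Suc, of "a + 1"] by (simp only: power_Suc)
    moreover have "(a + 1) * (a ^ b + b * a ^ (b - 1)) \<ge> a ^ Suc b + Suc b * a ^ b"
      by (cases b) (auto simp: algebra_simps)
    ultimately show ?case by simp
  qed simp
  have "2 * a ^ m < a ^ m + m * a ^ (m - 1)" using a by simp
  also have "\<dots> \<le> (a + 1) ^ m" by (rule bern)
  finally show ?thesis using a by simp
qed

text \<open>This beats the union bound below: \<open>2 ^ n\<close> accounts for the point sets and
  \<open>m ^ n\<close> for the omitted labels. It combines \<open>2 * m \<le> 2 ^ m\<close> with the
  \<open>m\<close>-th power of the preceding inequality; further factors \<open>m - 1\<close>
  against \<open>m\<close> only help.\<close>

lemma pred_power_less_power:
  fixes m n e :: nat
  assumes m: "m \<ge> 2" and n: "n > 0" and e: "e \<ge> m ^ 2 * n"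
  shows "(2 * m) ^ n * (m - 1) ^ e < m ^ e"
proof -
  have "2 * m \<le> 2 ^ m" using m
  proof (induction m rule: dec_induct)
    case (step i)
    then show ?case by simp
  qed simp
  then have "2 * m * (m - 1) ^ (m * m) \<le> 2 ^ m * ((m - 1) ^ m) ^ m"
    by (simp add: power_mult)
  also have "\<dots> = (2 * (m - 1) ^ m) ^ m" by (simp add: power_mult_distrib)
  also have "\<dots> < (m ^ m) ^ m"
    using two_mult_pred_power_less[OF m] m by (intro power_strict_mono) auto
  finally have "2 * m * (m - 1) ^ (m ^ 2) < m ^ (m ^ 2)"
    by (simp add: power_mult[symmetric] power2_eq_square)
  then have "(2 * m * (m - 1) ^ (m ^ 2)) ^ n < (m ^ (m ^ 2)) ^ n"
    using n by (intro power_strict_mono) auto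
  then have base: "(2 * m) ^ n * (m - 1) ^ (m ^ 2 * n) < m ^ (m ^ 2 * n)"
    by (simp only: power_mult_distrib power_mult)
  obtain d where d: "e = m ^ 2 * n + d" using e le_Suc_ex by blast
  have "(2 * m) ^ n * (m - 1) ^ e = ((2 * m) ^ n * (m - 1) ^ (m ^ 2 * n)) * (m - 1) ^ d"
    by (simp add: d power_add)
  also have "\<dots> \<le> ((2 * m) ^ n * (m - 1) ^ (m ^ 2 * n)) * m ^ d"
    by (intro mult_left_mono power_mono) auto
  also have "\<dots> < m ^ (m ^ 2 * n) * m ^ d"
    using base m by simp
  finally show ?thesis by (simp add: d power_add)
qed

text \<open>Counting: a set \<open>A\<close> is bad for few labellings, because on each line \<open>l\<close> the labellings that
  omit a value on \<open>A\<close> are at most \<open>m * (1 - 1/m) ^ a\<close> of all, where \<open>a\<close> is the number of points of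
  \<open>A\<close> on \<open>l\<close>, and these numbers add up to \<open>q * card A\<close>.\<close>
lemma ex_labelling:
  fixes L :: "'l set" and K :: "'s set" and P :: "'p set" and f :: "'l \<Rightarrow> 's \<Rightarrow> 'p"
  assumes fin: "finite L" "finite K" "finite P" and m: "m \<ge> 2" and n: "card L = n" "card P = n" "n > 0"
    and q: "card K = q" "q \<ge> m ^ 2 * r"
    and inc: "\<And>A. A \<subseteq> P \<Longrightarrow> (\<Sum>l\<in>L. card {s \<in> K. f l s \<in> A}) = q * card A"
  shows "\<exists>lab :: 'l \<Rightarrow> 's \<Rightarrow> nat. (\<forall>l \<in> L. \<forall>s \<in> K. lab l s < m) \<and>
    (\<forall>A \<subseteq> P. n \<le> r * card A \<longrightarrow> (\<exists>l \<in> L. \<forall>j < m. \<exists>s \<in> K. f l s \<in> A \<and> lab l s = j))"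
proof -
  define \<Omega> where "\<Omega> = (L \<rightarrow>\<^sub>E (K \<rightarrow>\<^sub>E {..<m}))"
  define omit where "omit A l j = (\<Pi>\<^sub>E s\<in>K. if f l s \<in> A then {..<m} - {j} else {..<m})" for A l and j :: nat
  define bad where "bad A = (\<Pi>\<^sub>E l\<in>L. \<Union>j<m. omit A l j)" for A
  have card\<Omega>: "card \<Omega> = m ^ (q * n)"
    by (simp add: \<Omega>_def card_PiE fin q n power_mult)
  have fin_omit: "finite (omit A l j)" for A l j
    unfolding omit_def using fin by (intro finite_PiE) auto
  \<comment> \<open>Both sides are multiplied by a power of \<open>m\<close>, so that the proportion
    \<open>(1 - 1/m) ^ a\<close> needs no division.\<close>
  have card_omit: "card (omit A l j) * m ^ card {s \<in> K. f l s \<in> A} = m ^ q * (m - 1) ^ card {s \<in> K. f l s \<in> A}"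
    if "j < m" for A l j
  proof -
    let ?a = "card {s \<in> K. f l s \<in> A}"
    have "card (omit A l j) = (\<Prod>s\<in>K. if f l s \<in> A then m - 1 else m)"
      unfolding omit_def using fin(2) that by (subst card_PiE) (auto intro!: prod.cong)
    also have "\<dots> = (m - 1) ^ ?a * m ^ card {s \<in> K. f l s \<notin> A}"
    proof -
      have "K \<inter> {s. f l s \<in> A} = {s \<in> K. f l s \<in> A}" "K \<inter> - {s. f l s \<in> A} = {s \<in> K. f l s \<notin> A}"
        by auto
      then show ?thesis by (subst prod.If_cases[OF fin(2)]) simp
    qed
    finally have "card (omit A l j) * m ^ ?a = (m - 1) ^ ?a * m ^ (card {s \<in> K. f l s \<notin> A} + ?a)"
      by (simp add: power_add)
    moreover have "card {s \<in> K. f l s \<notin> A} + ?a = q"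
      unfolding q(1)[symmetric] using fin(2) by (subst card_Un_disjoint[symmetric]) (auto intro: arg_cong[of _ _ card])
    ultimately show ?thesis by (simp add: mult.commute)
  qed
  have card_bad: "card (bad A) * m ^ (q * card A) \<le> m ^ n * m ^ (q * n) * (m - 1) ^ (q * card A)"
    if A: "A \<subseteq> P" for A
  proof -
    let ?a = "\<lambda>l. card {s \<in> K. f l s \<in> A}"
    have "card (bad A) * m ^ (q * card A) = (\<Prod>l\<in>L. card (\<Union>j<m. omit A l j) * m ^ ?a l)"
      unfolding bad_def inc[OF A, symmetric] using fin(1) by (simp add: card_PiE prod.distrib power_sum)
    also have "\<dots> \<le> (\<Prod>l\<in>L. m * m ^ q * (m - 1) ^ ?a l)"
    proof (rule prod_mono, intro conjI)
      fix l assume "l \<in> L"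
      have "card (\<Union>j<m. omit A l j) * m ^ ?a l \<le> (\<Sum>j<m. card (omit A l j)) * m ^ ?a l"
        by (intro mult_right_mono card_UN_le) auto
      also have "\<dots> = m * (m ^ q * (m - 1) ^ ?a l)"
        by (simp add: sum_distrib_right card_omit)
      finally show "card (\<Union>j<m. omit A l j) * m ^ ?a l \<le> m * m ^ q * (m - 1) ^ ?a l"
        by (simp add: mult.assoc)
    qed simp
    also have "\<dots> = m ^ n * m ^ (q * n) * (m - 1) ^ (q * card A)"
      unfolding inc[OF A, symmetric] using n by (simp add: prod.distrib power_sum power_mult power_mult_distrib)
    finally show ?thesis .
  qed
  have few: "2 ^ n * card (bad A) < m ^ (q * n)" if A: "A \<subseteq> P" "n \<le> r * card A" for A
  proof -
    \<comment> \<open>The size of \<open>A\<close> and \<open>q \<ge> m ^ 2 * r\<close> make the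
      exponent at least \<open>m ^ 2 * n\<close>.\<close>
    have "m ^ 2 * n \<le> m ^ 2 * (r * card A)" using A(2) by simp
    also have "\<dots> \<le> q * card A" using q(2) by (metis mult.assoc mult_le_mono1)
    finally have "(2 * m) ^ n * (m - 1) ^ (q * card A) < m ^ (q * card A)"
      using pred_power_less_power[OF m n(3)] by blast
    then have "m ^ (q * n) * ((2 * m) ^ n * (m - 1) ^ (q * card A)) < m ^ (q * n) * m ^ (q * card A)"
      using m by simp
    moreover have "2 ^ n * card (bad A) * m ^ (q * card A) \<le> 2 ^ n * (m ^ n * m ^ (q * n) * (m - 1) ^ (q * card A))"
      using card_bad[OF A(1)] by (simp add: mult.assoc)
    moreover have "2 ^ n * (m ^ n * m ^ (q * n) * (m - 1) ^ (q * card A)) =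
        m ^ (q * n) * ((2 * m) ^ n * (m - 1) ^ (q * card A))"
      by (simp add: power_mult_distrib)
    ultimately have "2 ^ n * card (bad A) * m ^ (q * card A) < m ^ (q * n) * m ^ (q * card A)" by linarith
    then show ?thesis by simp
  qed
  define \<S> where "\<S> = {A. A \<subseteq> P \<and> n \<le> r * card A}"
  have fin\<S>: "finite \<S>" by (rule finite_subset[of _ "Pow P"]) (auto simp: \<S>_def fin)
  have card\<S>: "card \<S> \<le> 2 ^ n"
    using card_mono[of "Pow P" \<S>] fin(3) n(2) by (auto simp: \<S>_def card_Pow)
  have "\<exists>\<phi> \<in> \<Omega>. \<forall>A \<in> \<S>. \<phi> \<notin> bad A"
  proof (cases "\<S> = {}")
    case True
    have "card \<Omega> > 0" using card\<Omega> m by simp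
    then show ?thesis using True by (metis card_gt_0_iff ex_in_conv empty_iff)
  next
    case False
    \<comment> \<open>Union bound: there are at most \<open>2 ^ n\<close> sets, each bad for less
      than a fraction \<open>1 / 2 ^ n\<close> of all labellings. The strict comparison of the sums
      uses that \<open>\<S>\<close> is nonempty.\<close>
    have "2 ^ n * card (\<Union>A\<in>\<S>. bad A) \<le> 2 ^ n * (\<Sum>A\<in>\<S>. card (bad A))"
      using card_UN_le[OF fin\<S>, of bad] by simp
    also have "\<dots> = (\<Sum>A\<in>\<S>. 2 ^ n * card (bad A))" by (simp add: sum_distrib_left)
    also have "\<dots> < (\<Sum>A\<in>\<S>. m ^ (q * n))"
      using few by (intro sum_strict_mono[OF fin\<S> False]) (auto simp: \<S>_def)
    also have "\<dots> \<le> 2 ^ n * m ^ (q * n)" using card\<S> by simp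
    finally have "card (\<Union>A\<in>\<S>. bad A) < card \<Omega>" by (simp add: card\<Omega>)
    moreover have "finite (\<Union>A\<in>\<S>. bad A)"
      using fin\<S> fin fin_omit unfolding bad_def by (intro finite_UN_I finite_PiE) auto
    ultimately have "\<not> \<Omega> \<subseteq> (\<Union>A\<in>\<S>. bad A)" using card_mono by (metis not_le)
    then show ?thesis by blast
  qed
  then obtain \<phi> where \<phi>: "\<phi> \<in> \<Omega>" "\<And>A. A \<in> \<S> \<Longrightarrow> \<phi> \<notin> bad A" by blast
  have \<phi>K: "\<phi> l \<in> K \<rightarrow>\<^sub>E {..<m}" if "l \<in> L" for l using \<phi>(1) that by (auto simp: \<Omega>_def)
  have "\<exists>l \<in> L. \<forall>j < m. \<exists>s \<in> K. f l s \<in> A \<and> \<phi> l s = j" if A: "A \<subseteq> P" "n \<le> r * card A" for A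
  proof (rule ccontr)
    assume no: "\<not> ?thesis"
    have "\<phi> \<in> bad A"
      unfolding bad_def
    proof (rule PiE_I)
      fix l assume l: "l \<in> L"
      then obtain j where j: "j < m" "\<forall>s \<in> K. f l s \<in> A \<longrightarrow> \<phi> l s \<noteq> j" using no by blast
      have "\<phi> l \<in> omit A l j"
        unfolding omit_def using \<phi>K[OF l] j(2) by (auto simp: PiE_iff)
      then show "\<phi> l \<in> (\<Union>j<m. omit A l j)" using j(1) by blast
    next
      fix l assume "l \<notin> L"
      then show "\<phi> l = undefined" using \<phi>(1) by (auto simp: \<Omega>_def)
    qed
    then show False using \<phi>(2)[of A] A by (auto simp: \<S>_def)
  qed
  moreover have "\<forall>l \<in> L. \<forall>s \<in> K. \<phi> l s < m" using \<phi>K by (fastforce simp: PiE_iff)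
  ultimately show ?thesis by blast
qed

section \<open>A colour pattern from lines without triangles\<close>

text \<open>The line \<open>(x, b, c)\<close> passes through \<open>(0, b, c)\<close>. Its parameter
  is the first coordinate, so two lines can meet only at equal parameters.\<close>

definition line_pt :: "'a \<Rightarrow> 'a \<times> 'a \<times> 'a \<Rightarrow> 'a \<Rightarrow> 'a \<times> 'a \<times> 'a :: field" where
  "line_pt t l s = (case l of (x, b, c) \<Rightarrow> (s, b + s * x, c + s * (x\<^sup>2 + t)))"

text \<open>Two common points determine the direction: the second coordinate gives
  \<open>x = x'\<close>, and then the third gives \<open>t = t'\<close>. Hence graphs for different
  \<open>t\<close> share no edge.\<close>

lemma line_pt_param:
  assumes "s \<noteq> s'" "line_pt t l s = line_pt t' l' s" "line_pt t l s' = line_pt t' l' s'"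
  shows "t = t'"
proof -
  obtain x b c x' b' c' where l: "l = (x, b, c)" "l' = (x', b', c')" by (metis prod.exhaust)
  have e: "b + s * x = b' + s * x'" "b + s' * x = b' + s' * x'"
    "c + s * (x\<^sup>2 + t) = c' + s * (x'\<^sup>2 + t')" "c + s' * (x\<^sup>2 + t) = c' + s' * (x'\<^sup>2 + t')"
    using assms by (auto simp: line_pt_def l)
  have "(s - s') * (x - x') = (b + s * x) - (b + s' * x) - ((b' + s * x') - (b' + s' * x'))"
    by (simp add: algebra_simps)
  also have "\<dots> = 0" using e by simp
  finally have x: "x = x'" using assms(1) by simp
  have "(s - s') * (t - t') = (c + s * (x\<^sup>2 + t)) - (c + s' * (x\<^sup>2 + t))
      - ((c' + s * (x'\<^sup>2 + t')) - (c' + s' * (x'\<^sup>2 + t')))"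
    unfolding x by (simp add: algebra_simps)
  also have "\<dots> = 0" using e by simp
  finally show ?thesis using assms(1) by simp
qed

text \<open>No three of the directions \<open>(1, x, x\<^sup>2 + t)\<close> are linearly dependent, so the lines
  form no triangles.\<close>
lemma line_pt_triangle:
  fixes s0 s1 s2 t :: "'a :: field"
  assumes d: "s0 \<noteq> s1" "s1 \<noteq> s2" "s0 \<noteq> s2"
    and e: "line_pt t l s1 = line_pt t l' s1" "line_pt t l s0 = line_pt t l'' s0"
      "line_pt t l' s2 = line_pt t l'' s2"
  shows "l = l'"
proof -
  obtain x b c x' b' c' x'' b'' c'' where l: "l = (x, b, c)" "l' = (x', b', c')" "l'' = (x'', b'', c'')"
    by (metis prod.exhaust)
  have e: "b + s1 * x = b' + s1 * x'" "b + s0 * x = b'' + s0 * x''" "b' + s2 * x' = b'' + s2 * x''"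
    "c + s1 * (x\<^sup>2 + t) = c' + s1 * (x'\<^sup>2 + t)" "c + s0 * (x\<^sup>2 + t) = c'' + s0 * (x''\<^sup>2 + t)"
    "c' + s2 * (x'\<^sup>2 + t) = c'' + s2 * (x''\<^sup>2 + t)"
    using e by (auto simp: line_pt_def l)
  \<comment> \<open>The sides of a triangle add up to zero; this is that relation in one coordinate,
    with slopes \<open>D\<close>, \<open>D'\<close>, \<open>D''\<close>. It serves for the second
    and the third coordinate.\<close>
  have chord: "(s2 - s0) * D'' = (s1 - s0) * D + (s2 - s1) * D'"
    if "B + s1 * D = B' + s1 * D'" "B + s0 * D = B'' + s0 * D''" "B' + s2 * D' = B'' + s2 * D''"
    for B B' B'' D D' D'' :: 'a
  proof -
    have "(s2 - s0) * D'' - ((s1 - s0) * D + (s2 - s1) * D') =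
        ((B'' + s2 * D'') - (B' + s2 * D')) - ((B'' + s0 * D'') - (B + s0 * D)) + ((B' + s1 * D') - (B + s1 * D))"
      by (simp add: algebra_simps)
    also have "\<dots> = 0" using that by simp
    finally show ?thesis by simp
  qed
  define \<alpha> \<beta> where "\<alpha> = s1 - s0" and "\<beta> = s2 - s1"
  have sum: "s2 - s0 = \<alpha> + \<beta>" by (simp add: \<alpha>_def \<beta>_def)
  have lin: "(\<alpha> + \<beta>) * x'' = \<alpha> * x + \<beta> * x'"
    using chord[OF e(1-3)] by (simp only: sum \<alpha>_def[symmetric] \<beta>_def[symmetric])
  have "(\<alpha> + \<beta>) * (x''\<^sup>2 + t) = \<alpha> * (x\<^sup>2 + t) + \<beta> * (x'\<^sup>2 + t)"
    using chord[OF e(4-6)] by (simp only: sum \<alpha>_def[symmetric] \<beta>_def[symmetric])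
  then have quad: "(\<alpha> + \<beta>) * x''\<^sup>2 = \<alpha> * x\<^sup>2 + \<beta> * x'\<^sup>2"
    by (simp add: algebra_simps)
  \<comment> \<open>This is the formula for the variance of \<open>x\<close> and \<open>x'\<close>
    with weights \<open>\<alpha>\<close> and \<open>\<beta>\<close>, up to scaling. It vanishes by
    the two relations above, and the weights are nonzero since the parameters differ.\<close>
  have "\<alpha> * \<beta> * (x - x')\<^sup>2 = (\<alpha> + \<beta>) * (\<alpha> * x\<^sup>2 + \<beta> * x'\<^sup>2) - (\<alpha> * x + \<beta> * x')\<^sup>2"
    by (simp add: algebra_simps power2_eq_square)
  also have "\<dots> = 0"
    unfolding lin[symmetric] quad[symmetric] by (simp add: power2_eq_square)
  finally have "\<alpha> * \<beta> * (x - x')\<^sup>2 = 0" .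
  then have x: "x = x'" using d unfolding \<alpha>_def \<beta>_def by simp
  then show ?thesis using e(1,4) l by simp
qed

text \<open>Double counting: a point of \<open>A\<close> and a slope \<open>x\<close> in
  \<open>K\<close> determine exactly one line of the family through the point.\<close>

lemma line_pt_incidences:
  fixes K :: "'a :: field set"
  assumes K: "finite K" "\<And>x y. x \<in> K \<Longrightarrow> y \<in> K \<Longrightarrow> x + y \<in> K \<and> x - y \<in> K \<and> x * y \<in> K" "t \<in> K"
    and A: "A \<subseteq> K \<times> K \<times> K"
  shows "(\<Sum>l\<in>K \<times> K \<times> K. card {s \<in> K. line_pt t l s \<in> A}) = card K * card A"
proof -
  have "(\<Sum>l\<in>K \<times> K \<times> K. card {s \<in> K. line_pt t l s \<in> A}) =
      card (SIGMA l:K \<times> K \<times> K. {s \<in> K. line_pt t l s \<in> A})"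
    using K(1) by (subst card_SigmaI) auto
  also have "\<dots> = card (K \<times> A)"
  proof (rule bij_betw_same_card)
    show "bij_betw (\<lambda>(l, s). (fst l, line_pt t l s)) (SIGMA l:K \<times> K \<times> K. {s \<in> K. line_pt t l s \<in> A}) (K \<times> A)"
    proof (rule bij_betw_byWitness[where f' = "\<lambda>(x, (s, y, z)). ((x, y - s * x, z - s * (x\<^sup>2 + t)), s)"])
      show "(\<lambda>(x, (s, y, z)). ((x, y - s * x, z - s * (x\<^sup>2 + t)), s)) ` (K \<times> A)
          \<subseteq> (SIGMA l:K \<times> K \<times> K. {s \<in> K. line_pt t l s \<in> A})"
      proof clarsimp
        fix x s y z assume "x \<in> K" "(s, y, z) \<in> A"
        moreover then have "s \<in> K" "y \<in> K" "z \<in> K" using A by auto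
        ultimately show "y - s * x \<in> K \<and> z - s * (x\<^sup>2 + t) \<in> K \<and> s \<in> K \<and>
            line_pt t (x, y - s * x, z - s * (x\<^sup>2 + t)) s \<in> A"
          using K(2,3) by (simp add: power2_eq_square line_pt_def)
      qed
    qed (auto simp: line_pt_def)
  qed
  finally show ?thesis using K(1) by (simp add: card_cartesian_product)
qed

lemma ex_power2_between:
  fixes x :: nat
  assumes "x \<ge> 2"
  obtains j where "j > 0" "x \<le> 2 ^ j" "2 ^ j \<le> 2 * x"
proof -
  define j where "j = (LEAST j. x \<le> 2 ^ j)"
  have "\<exists>j. x \<le> 2 ^ j" using less_exp[of x] less_imp_le by blast
  then have j: "x \<le> 2 ^ j" unfolding j_def by (rule LeastI_ex)
  then have "j > 0" using assms by (cases j) auto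
  then obtain i where i: "j = Suc i" by (cases j) auto
  then have "\<not> x \<le> 2 ^ i" using not_less_Least[of i "\<lambda>j. x \<le> 2 ^ j"] j_def by simp
  then show thesis using that[of j] j \<open>j > 0\<close> i by simp
qed

text \<open>Edges of colour \<open>i\<close> join points with different labels on a line with
  parameter \<open>\<tau> i\<close>. As these lines form no triangle, a monochromatic clique lies on
  one line, which has only \<open>m\<close> labels. By pigeonhole some colour class of
  \<open>f\<close> has at least \<open>n / r\<close> points, and the labelling provides a line on
  which it meets all \<open>m\<close> parts.\<close>

theorem colour_pattern:
  fixes m r :: nat
  assumes m: "m \<ge> 2" and r: "r > 0"
  obtains n :: nat and E :: "nat set set" and \<psi> where
    "n > 0" "n \<le> 8 * m ^ 6 * r ^ 3" "E \<subseteq> [{..<n}]\<^bsup>2\<^esup>" "\<And>e. \<psi> e < r"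
    "\<And>Q c. Q \<subseteq> {..<n} \<Longrightarrow> card Q = Suc m \<Longrightarrow> [Q]\<^bsup>2\<^esup> \<subseteq> E \<Longrightarrow> \<not> mono_set \<psi> Q c"
    "\<And>f. (\<And>v. v < n \<Longrightarrow> f v < r) \<Longrightarrow>
       \<exists>i < r. \<exists>Q \<subseteq> {..<n}. card Q = m \<and> [Q]\<^bsup>2\<^esup> \<subseteq> E \<and> mono_set \<psi> Q i \<and> (\<forall>v \<in> Q. f v = i)"
proof -
  have "m ^ 2 * r \<ge> 2 ^ 2 * 1" using m r by (intro mult_mono power_mono) auto
  then have "m ^ 2 * r \<ge> 2" by simp
  then obtain j where j: "j > 0" "m ^ 2 * r \<le> 2 ^ j" "2 ^ j \<le> 2 * (m ^ 2 * r)"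
    by (rule ex_power2_between)
  define q where "q = (2 :: nat) ^ j"
  define K where "K = frob_fixed j"
  have cK: "card K = q" by (simp add: K_def q_def card_frob_fixed j)
  have "q > 0" by (simp add: q_def)
  then have finK: "finite K" using cK card_gt_0_iff by metis
  have Kcl: "x + y \<in> K \<and> x - y \<in> K \<and> x * y \<in> K" if "x \<in> K" "y \<in> K" for x y
    using frob_fixed_closed[of x j y] that by (simp add: K_def)
  define P where "P = K \<times> K \<times> K"
  define n where "n = q ^ 3"
  have cP: "card P = n" by (simp add: P_def card_cartesian_product cK n_def power3_eq_cube)
  have finP: "finite P" by (simp add: P_def finK)
  have n0: "n > 0" using \<open>q > 0\<close> by (simp add: n_def)
  have "n \<le> (2 * (m ^ 2 * r)) ^ 3" unfolding n_def q_def using j by (intro power_mono) auto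
  also have "\<dots> = 8 * m ^ 6 * r ^ 3" by (simp add: power_mult_distrib power_mult[symmetric])
  finally have n_le: "n \<le> 8 * m ^ 6 * r ^ 3" .
  \<comment> \<open>The colours are embedded into the field as parameters \<open>t\<close>, which
    needs \<open>r \<le> q\<close>.\<close>
  have "r \<le> m ^ 2 * r" using m by simp
  then have "r \<le> q" using j(2) unfolding q_def by (rule order_trans)
  then have "card {..<r} \<le> card K" by (simp add: cK)
  then obtain \<tau> where \<tau>: "inj_on \<tau> {..<r}" "\<tau> ` {..<r} \<subseteq> K"
    using card_le_inj[of "{..<r}" K] finK by auto
  have \<tau>K: "\<tau> i \<in> K" if "i < r" for i using \<tau>(2) that by auto
  define good where "good i lab \<longleftrightarrow> (\<forall>l \<in> P. \<forall>s \<in> K. lab l s < m) \<and>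
    (\<forall>A \<subseteq> P. n \<le> r * card A \<longrightarrow> (\<exists>l \<in> P. \<forall>j < m. \<exists>s \<in> K. line_pt (\<tau> i) l s \<in> A \<and> lab l s = j))"
    for i lab
  have "\<exists>lab. good i lab" if "i \<in> {..<r}" for i
    unfolding good_def
  proof (rule ex_labelling[OF finP finK finP m cP cP n0 cK])
    show "m ^ 2 * r \<le> q" using j by (simp add: q_def)
    have "i < r" using that by simp
    then show "(\<Sum>l\<in>P. card {s \<in> K. line_pt (\<tau> i) l s \<in> A}) = q * card A" if "A \<subseteq> P" for A
      using line_pt_incidences[OF finK Kcl \<tau>K, of i A] that by (simp add: P_def cK)
  qed
  then obtain lab where good: "\<And>i. i \<in> {..<r} \<Longrightarrow> good i (lab i)"
    using bchoice[of "{..<r}" good] by blast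
  have lab: "lab i l s < m" if "i < r" "l \<in> P" "s \<in> K" for i l s
    using good[of i] that by (auto simp: good_def)
  have lab': "\<exists>l \<in> P. \<forall>j < m. \<exists>s \<in> K. line_pt (\<tau> i) l s \<in> A \<and> lab i l s = j"
    if "i < r" "A \<subseteq> P" "n \<le> r * card A" for i A
    using good[of i] that by (simp add: good_def)
  obtain \<beta> where \<beta>: "bij_betw \<beta> {..<n} P"
    using ex_bij_betw_nat_finite[OF finP] cP by (auto simp: atLeast0LessThan)
  have \<beta>_inj: "u = v" if "u < n" "v < n" "\<beta> u = \<beta> v" for u v
    using \<beta> that by (auto simp: bij_betw_def inj_on_def)
  text \<open>The first coordinate of a point is its parameter on each line through it.\<close>
  define on where "on i l u v \<longleftrightarrow> l \<in> P \<and> fst (\<beta> u) \<in> K \<and> fst (\<beta> v) \<in> K \<and> fst (\<beta> u) \<noteq> fst (\<beta> v) \<and>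
      \<beta> u = line_pt (\<tau> i) l (fst (\<beta> u)) \<and> \<beta> v = line_pt (\<tau> i) l (fst (\<beta> v)) \<and>
      lab i l (fst (\<beta> u)) \<noteq> lab i l (fst (\<beta> v))" for i l u v
  have on_sym: "on i l u v \<Longrightarrow> on i l v u" for i l u v by (auto simp: on_def)
  have on_colour: "i = i'" if "on i l u v" "on i' l' u v" "i < r" "i' < r" for i i' l l' u v
  proof -
    have "\<tau> i = \<tau> i'"
      using that line_pt_param[of "fst (\<beta> u)" "fst (\<beta> v)" "\<tau> i" l "\<tau> i'" l'] unfolding on_def by metis
    then show ?thesis using \<tau>(1) that by (auto simp: inj_on_def)
  qed
  have on_tri: "l = l'" if "on i l u v" "on i l' v w" "on i l'' u w" for i l l' l'' u v w
    using that line_pt_triangle[of "fst (\<beta> u)" "fst (\<beta> v)" "fst (\<beta> w)" "\<tau> i" l l' l''] unfolding on_def by metis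
  define E where "E = {e \<in> [{..<n}]\<^bsup>2\<^esup>. \<exists>i < r. \<exists>l u v. e = {u, v} \<and> on i l u v}"
  \<comment> \<open>By \<open>on_colour\<close> the choice is unique on edges; sets without a
    suitable line get 0.\<close>
  define \<psi> where "\<psi> e = (if \<exists>i < r. \<exists>l u v. e = {u, v} \<and> on i l u v
     then (SOME i. i < r \<and> (\<exists>l u v. e = {u, v} \<and> on i l u v)) else 0)" for e
  have \<psi>_eq: "\<psi> {u, v} = i" if "on i l u v" "i < r" for i l u v
  proof -
    have uniq: "i' = i" if i': "i' < r" "\<exists>l' u' v'. {u, v} = {u', v'} \<and> on i' l' u' v'" for i'
    proof -
      obtain l' where "on i' l' u v" using i'(2) on_sym by (metis doubleton_eq_iff)
      then show ?thesis using on_colour \<open>on i l u v\<close> \<open>i < r\<close> i'(1) by blast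
    qed
    have "\<exists>l' u' v'. {u, v} = {u', v'} \<and> on i l' u' v'" using \<open>on i l u v\<close> by blast
    then have i: "i < r \<and> (\<exists>l' u' v'. {u, v} = {u', v'} \<and> on i l' u' v')" using \<open>i < r\<close> by blast
    then have "(SOME i. i < r \<and> (\<exists>l' u' v'. {u, v} = {u', v'} \<and> on i l' u' v')) = i"
      by (rule some_equality) (use uniq in blast)
    moreover have "\<exists>i < r. \<exists>l' u' v'. {u, v} = {u', v'} \<and> on i l' u' v'" using i by blast
    ultimately show ?thesis unfolding \<psi>_def by (simp only: if_True)
  qed
  have \<psi>_less: "\<psi> e < r" for e
    unfolding \<psi>_def using r someI_ex[of "\<lambda>i. i < r \<and> (\<exists>l u v. e = {u, v} \<and> on i l u v)"] by auto
  have E_on: "\<exists>l. on (\<psi> {u, v}) l u v" if uv: "{u, v} \<in> E" for u v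
  proof -
    obtain i l u' v' where i: "i < r" "{u, v} = {u', v'}" "on i l u' v'" using uv unfolding E_def by blast
    then have "on i l u v" using on_sym by (metis doubleton_eq_iff)
    then show ?thesis using \<psi>_eq i(1) by blast
  qed
  have free: "\<not> mono_set \<psi> Q c" if Q: "Q \<subseteq> {..<n}" "card Q = Suc m" "[Q]\<^bsup>2\<^esup> \<subseteq> E" for Q c
  proof
    assume mono: "mono_set \<psi> Q c"
    have edge: "\<exists>l. on c l u v" if uv: "u \<in> Q" "v \<in> Q" "u \<noteq> v" for u v
    proof -
      have "{u, v} \<in> E" using Q(3) uv by auto
      then show ?thesis using E_on mono_setD[OF mono uv] by metis
    qed
    have finQ: "finite Q" using Q(1) finite_subset by blast
    obtain T where "T \<subseteq> Q" "card T = 2" using Q(2) m by (metis obtain_subset_with_card_n le_SucI)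
    then obtain u0 u1 where u: "u0 \<in> Q" "u1 \<in> Q" "u0 \<noteq> u1" by (auto simp: card_2_iff)
    then obtain l where l: "on c l u0 u1" using edge by blast
    \<comment> \<open>The triangle on \<open>u0\<close>, \<open>u1\<close>, \<open>w\<close> puts
      \<open>w\<close> on the line \<open>l\<close> through \<open>u0\<close> and \<open>u1\<close>.
      A further triangle at \<open>u0\<close> then places every pair of \<open>Q\<close> on
      \<open>l\<close>.\<close>
    have u0: "on c l u0 w" if w: "w \<in> Q" "w \<noteq> u0" for w
    proof (cases "w = u1")
      case False
      obtain l' l'' where "on c l' u0 w" "on c l'' w u1" using edge u w False by metis
      then show ?thesis using on_tri[of c l' u0 w l'' u1] on_tri[of c l u1 u0 l' w] on_tri l on_sym by metis
    qed (use l in simp)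
    have "on c l v w" if vw: "v \<in> Q" "w \<in> Q" "v \<noteq> w" for v w
    proof -
      consider "v = u0" | "w = u0" | "v \<noteq> u0" "w \<noteq> u0" by blast
      then show ?thesis
      proof cases
        case 3
        obtain l' where "on c l' v w" using edge vw by blast
        then show ?thesis using on_tri[of c l u0 v l' w l] u0 vw 3 by metis
      qed (use u0 vw on_sym in auto)
    qed
    then have pair: "l \<in> P" "fst (\<beta> v) \<in> K" "lab c l (fst (\<beta> v)) \<noteq> lab c l (fst (\<beta> w))"
      if "v \<in> Q" "w \<in> Q" "v \<noteq> w" for v w
      using that unfolding on_def by blast+
    have "c < r" using mono_setD[OF mono u] \<psi>_less by metis
    have "inj_on (\<lambda>v. lab c l (fst (\<beta> v))) Q" using pair(3) by (auto intro: inj_onI)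
    moreover have "(\<lambda>v. lab c l (fst (\<beta> v))) ` Q \<subseteq> {..<m}"
    proof
      fix x assume "x \<in> (\<lambda>v. lab c l (fst (\<beta> v))) ` Q"
      then obtain v where v: "v \<in> Q" "x = lab c l (fst (\<beta> v))" by blast
      obtain w where "w \<in> Q" "v \<noteq> w" using u by metis
      then show "x \<in> {..<m}" using pair(1,2)[OF v(1)] lab[OF \<open>c < r\<close>] v(2) by simp
    qed
    ultimately have "card Q \<le> card {..<m}" by (intro card_inj_on_le) auto
    then show False using Q(2) by simp
  qed
  have rich: "\<exists>i < r. \<exists>Q \<subseteq> {..<n}. card Q = m \<and> [Q]\<^bsup>2\<^esup> \<subseteq> E \<and> mono_set \<psi> Q i \<and> (\<forall>v \<in> Q. f v = i)"
    if f: "\<And>v. v < n \<Longrightarrow> f v < r" for f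
  proof -
    have "\<exists>i < r. n \<le> r * card {v. v < n \<and> f v = i}"
    proof (rule ccontr)
      assume "\<not> ?thesis"
      then have *: "r * card {v. v < n \<and> f v = i} < n" if "i < r" for i using that by force
      have "n = card (\<Union>i<r. {v. v < n \<and> f v = i})"
      proof -
        have "(\<Union>i<r. {v. v < n \<and> f v = i}) = {..<n}" using f by auto
        then show ?thesis by simp
      qed
      also have "\<dots> \<le> (\<Sum>i<r. card {v. v < n \<and> f v = i})" by (intro card_UN_le) auto
      finally have "r * n \<le> (\<Sum>i<r. r * card {v. v < n \<and> f v = i})" by (simp add: sum_distrib_left[symmetric])
      also have "\<dots> < (\<Sum>i<r. n)" using * r by (intro sum_strict_mono) auto
      finally show False by simp
    qed
    then obtain i where i: "i < r" "n \<le> r * card {v. v < n \<and> f v = i}" by blast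
    define A where "A = \<beta> ` {v. v < n \<and> f v = i}"
    have "inj_on \<beta> {v. v < n \<and> f v = i}" using \<beta>_inj by (auto intro: inj_onI)
    then have cA: "n \<le> r * card A" unfolding A_def using i(2) by (simp add: card_image)
    have AP: "A \<subseteq> P" unfolding A_def using bij_betwE[OF \<beta>] by auto
    obtain l where l: "l \<in> P" "\<forall>j < m. \<exists>s \<in> K. line_pt (\<tau> i) l s \<in> A \<and> lab i l s = j"
      using lab'[OF i(1) AP cA] by blast
    then have "\<forall>j < m. \<exists>v. v < n \<and> f v = i \<and> fst (\<beta> v) \<in> K \<and> \<beta> v = line_pt (\<tau> i) l (fst (\<beta> v)) \<and> lab i l (fst (\<beta> v)) = j"
    proof (intro allI impI)
      fix j assume "j < m"
      then obtain s where s: "s \<in> K" "line_pt (\<tau> i) l s \<in> A" "lab i l s = j" using l by blast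
      then obtain v where v: "v < n" "f v = i" "line_pt (\<tau> i) l s = \<beta> v" unfolding A_def by blast
      have "fst (\<beta> v) = s" unfolding v(3)[symmetric] by (simp add: line_pt_def split: prod.split)
      then show "\<exists>v. v < n \<and> f v = i \<and> fst (\<beta> v) \<in> K \<and> \<beta> v = line_pt (\<tau> i) l (fst (\<beta> v)) \<and> lab i l (fst (\<beta> v)) = j"
        using s v by metis
    qed
    then obtain w where w: "\<And>j. j < m \<Longrightarrow> w j < n \<and> f (w j) = i \<and> fst (\<beta> (w j)) \<in> K \<and>
        \<beta> (w j) = line_pt (\<tau> i) l (fst (\<beta> (w j))) \<and> lab i l (fst (\<beta> (w j))) = j" by metis
    have won: "on i l (w j) (w j')" if "j < m" "j' < m" "j \<noteq> j'" for j j'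
      using w[OF that(1)] w[OF that(2)] that(3) l(1) unfolding on_def by metis
    have "inj_on w {..<m}" using w by (metis inj_onI lessThan_iff)
    then have "card (w ` {..<m}) = m" by (simp add: card_image)
    moreover have "w ` {..<m} \<subseteq> {..<n}" using w by auto
    moreover have "[w ` {..<m}]\<^bsup>2\<^esup> \<subseteq> E"
    proof
      fix e assume e: "e \<in> [w ` {..<m}]\<^bsup>2\<^esup>"
      then obtain j j' where jj: "e = {w j, w j'}" "j < m" "j' < m" "w j \<noteq> w j'" by (elim nsets2_E) auto
      then have "on i l (w j) (w j')" using won by metis
      moreover have "e \<in> [{..<n}]\<^bsup>2\<^esup>" using jj w by simp
      ultimately show "e \<in> E" unfolding E_def using jj(1) i(1) by blast
    qed
    moreover have "mono_set \<psi> (w ` {..<m}) i"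
    proof (rule mono_setI)
      fix x y assume "x \<in> w ` {..<m}" "y \<in> w ` {..<m}" "x \<noteq> y"
      then obtain j j' where "x = w j" "y = w j'" "j < m" "j' < m" "j \<noteq> j'" by blast
      then show "\<psi> {x, y} = i" using \<psi>_eq[OF won i(1)] by blast
    qed
    moreover have "\<forall>v \<in> w ` {..<m}. f v = i" using w by auto
    ultimately show ?thesis using i(1) by blast
  qed
  have "E \<subseteq> [{..<n}]\<^bsup>2\<^esup>" by (auto simp: E_def)
  then show thesis using that[OF n0 n_le _ \<psi>_less free rich] by blast
qed

section \<open>Ramsey-minimal graphs\<close>

definition clique_free_colouring ::
    "nat \<Rightarrow> nat \<Rightarrow> 'a set \<Rightarrow> 'a set set \<Rightarrow> ('a set \<Rightarrow> nat) \<Rightarrow> bool" where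
  "clique_free_colouring k r V E \<chi> \<longleftrightarrow> (\<forall>e \<in> E. \<chi> e < r) \<and>
     (\<forall>Q c. Q \<subseteq> V \<longrightarrow> card Q = k \<longrightarrow> [Q]\<^bsup>2\<^esup> \<subseteq> E \<longrightarrow> \<not> mono_set \<chi> Q c)"

text \<open>\<open>\<A>\<close> consists of the \<open>k\<close>-sets that are not monochromatic
  under \<open>\<psi>0\<close>, and \<open>partite_ramsey\<close> is applied to the pattern and to
  the complete graphs on the members of \<open>\<A>\<close>. Pulling \<open>\<psi>0\<close> back
  along \<open>p\<close> gives a good colouring, as every \<open>k\<close>-clique projects into
  \<open>\<A>\<close>. Conversely, a good \<open>\<chi>\<close> induces a colouring of the pairs of
  \<open>W\<close> under which no member of \<open>\<A>\<close> is monochromatic, so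
  \<open>forcing_extension\<close> applies.\<close>

theorem forcing_graph:
  fixes k r :: nat and B :: "nat set" and EB :: "nat set set" and \<psi>B :: "nat set \<Rightarrow> nat"
  assumes k: "k \<ge> 3" and r: "r > 0" and B: "finite B" "EB \<subseteq> [B]\<^bsup>2\<^esup>" and \<psi>B: "\<And>e. \<psi>B e < r"
    and free: "\<And>Q c. Q \<subseteq> B \<Longrightarrow> card Q = k \<Longrightarrow> [Q]\<^bsup>2\<^esup> \<subseteq> EB \<Longrightarrow> \<not> mono_set \<psi>B Q c"
  obtains V :: "nat set" and E and \<chi>0 where
    "finite V" "E \<subseteq> [V]\<^bsup>2\<^esup>" "clique_free_colouring k r V E \<chi>0"
    "\<And>\<chi>. clique_free_colouring k r V E \<chi> \<Longrightarrow>
       \<exists>h \<pi>. inj_on h B \<and> h ` B \<subseteq> V \<and> inj_on \<pi> (\<psi>B ` [B]\<^bsup>2\<^esup>) \<and>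
         (\<forall>e \<in> EB. h ` e \<in> E \<and> \<chi> (h ` e) = \<pi> (\<psi>B e))"
proof -
  obtain W :: "ext set" and \<psi>0 and \<iota> where W: "finite W" "inj \<iota>" "\<iota> ` B \<subseteq> W" "\<And>e. \<psi>0 e < r"
    "\<And>e. e \<in> [B]\<^bsup>2\<^esup> \<Longrightarrow> \<psi>0 (\<iota> ` e) = \<psi>B e"
    and forced: "\<And>\<psi>. (\<And>e. e \<in> [W]\<^bsup>2\<^esup> \<Longrightarrow> \<psi> e < r) \<Longrightarrow>
       (\<And>Q c. Q \<subseteq> W \<Longrightarrow> card Q = k \<Longrightarrow> mono_set \<psi> Q c \<Longrightarrow> \<exists>d. mono_set \<psi>0 Q d) \<Longrightarrow>
       \<exists>\<pi>. inj_on \<pi> (\<psi>B ` [B]\<^bsup>2\<^esup>) \<and> (\<forall>e \<in> [B]\<^bsup>2\<^esup>. \<psi> (\<iota> ` e) = \<pi> (\<psi>B e))"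
    by (rule forcing_extension[where \<psi>B = \<psi>B, OF k r B(1) \<psi>B]) blast
  define \<A> where "\<A> = {Q. Q \<subseteq> W \<and> card Q = k \<and> (\<forall>c. \<not> mono_set \<psi>0 Q c)}"
  have "finite \<A>" by (rule finite_subset[of _ "Pow W"]) (auto simp: \<A>_def W)
  then obtain As where As: "set As = \<A>" using finite_list by blast
  define Ps where "Ps = (\<iota> ` B, (`) \<iota> ` EB) # map (\<lambda>Q. (Q, [Q]\<^bsup>2\<^esup>)) As"
  have pair: "\<iota> ` e \<in> [\<iota> ` B]\<^bsup>2\<^esup>" if "e \<in> EB" for e
  proof -
    have "e \<in> [B]\<^bsup>2\<^esup>" using that B(2) by blast
    then show ?thesis using W(2) by (auto elim!: nsets2_E simp: inj_eq)
  qed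
  have Ps_fin: "finite U \<and> F \<subseteq> [U]\<^bsup>2\<^esup>" if "(U, F) \<in> set Ps" for U F
    using that pair B(1) finite_subset[OF _ W(1)] unfolding Ps_def by (auto simp: As \<A>_def)
  have Ps_\<A>: "Q \<in> \<A>" if P: "(U, F) \<in> set Ps" and Q: "Q \<subseteq> U" "card Q = k" "[Q]\<^bsup>2\<^esup> \<subseteq> F" for U F Q
  proof -
    consider "U = \<iota> ` B" "F = (`) \<iota> ` EB" | "U \<in> \<A>" using P unfolding Ps_def by (auto simp: As)
    then show ?thesis
    proof cases
      case 1
      define Q0 where "Q0 = {b \<in> B. \<iota> b \<in> Q}"
      have im: "\<iota> ` Q0 = Q" using Q(1) 1 unfolding Q0_def by blast
      have "card Q0 = k" using Q(2) im card_image[OF inj_on_subset[OF W(2) subset_UNIV], of Q0] by simp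
      have cl: "[Q0]\<^bsup>2\<^esup> \<subseteq> EB"
      proof
        fix e assume e: "e \<in> [Q0]\<^bsup>2\<^esup>"
        then obtain x y where xy: "e = {x, y}" "x \<in> Q0" "y \<in> Q0" "x \<noteq> y" by (elim nsets2_E) auto
        then have "\<iota> ` e \<in> [Q]\<^bsup>2\<^esup>" using W(2) by (auto simp: Q0_def inj_eq)
        then have "\<iota> ` e \<in> (`) \<iota> ` EB" using Q(3) 1 by blast
        then show "e \<in> EB" using inj_image_eq_iff[OF W(2)] by auto
      qed
      have Q0B: "Q0 \<subseteq> B" by (auto simp: Q0_def)
      have "\<not> mono_set \<psi>0 Q c" for c
      proof
        assume m: "mono_set \<psi>0 Q c"
        have "mono_set \<psi>B Q0 c"
        proof (rule mono_setI)
          fix x y assume xy: "x \<in> Q0" "y \<in> Q0" "x \<noteq> y"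
          then have "\<psi>0 {\<iota> x, \<iota> y} = c"
            using mono_setD[OF m, of "\<iota> x" "\<iota> y"] W(2) by (auto simp: Q0_def inj_eq)
          moreover have "\<psi>0 (\<iota> ` {x, y}) = \<psi>B {x, y}" using xy Q0B by (intro W(5)) auto
          ultimately show "\<psi>B {x, y} = c" by simp
        qed
        then show False using free[OF Q0B \<open>card Q0 = k\<close> cl] by blast
      qed
      moreover have "Q \<subseteq> W" using im Q0B W(3) by blast
      ultimately show ?thesis using Q(2) by (simp add: \<A>_def)
    next
      case 2
      then have "finite U" "card U = k" using finite_subset[OF _ W(1)] by (auto simp: \<A>_def)
      then have "Q = U" using Q by (simp add: card_subset_eq)
      then show ?thesis using 2 by simp
    qed
  qed
  have "\<exists>V E p. partite k \<A> (V :: nat set) E p \<and>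
    (\<forall>\<chi>. (\<forall>e \<in> E. \<chi> e < r) \<longrightarrow> (\<exists>\<psi>. \<forall>(U, F) \<in> set Ps. \<exists>h. inj_on h U \<and> h ` U \<subseteq> V \<and>
       (\<forall>e \<in> F. h ` e \<in> E \<and> \<chi> (h ` e) = \<psi> e)))"
    by (rule partite_ramsey[OF k r]) (use Ps_fin in blast, use Ps_\<A> in blast)
  then obtain V :: "nat set" and E p where VE: "partite k \<A> V E p"
    and ramsey: "\<forall>\<chi>. (\<forall>e \<in> E. \<chi> e < r) \<longrightarrow> (\<exists>\<psi>. \<forall>(U, F) \<in> set Ps. \<exists>h. inj_on h U \<and> h ` U \<subseteq> V \<and>
       (\<forall>e \<in> F. h ` e \<in> E \<and> \<chi> (h ` e) = \<psi> e))"
    by (elim exE conjE)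
  have V: "finite V" "E \<subseteq> [V]\<^bsup>2\<^esup>" "\<And>e. e \<in> E \<Longrightarrow> inj_on p e"
    "\<And>Q. Q \<subseteq> V \<Longrightarrow> card Q = k \<Longrightarrow> [Q]\<^bsup>2\<^esup> \<subseteq> E \<Longrightarrow> p ` Q \<in> \<A>"
    using VE by (auto simp: partite_def)
  have col: "\<not> mono_set (\<lambda>e. \<psi>0 (p ` e)) Q c" if Q: "Q \<subseteq> V" "card Q = k" "[Q]\<^bsup>2\<^esup> \<subseteq> E" for Q c
  proof
    assume m: "mono_set (\<lambda>e. \<psi>0 (p ` e)) Q c"
    have "mono_set \<psi>0 (p ` Q) c"
    proof (rule mono_setI)
      fix a b assume "a \<in> p ` Q" "b \<in> p ` Q" "a \<noteq> b"
      then obtain x y where xy: "a = p x" "b = p y" "x \<in> Q" "y \<in> Q" "x \<noteq> y" by blast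
      then show "\<psi>0 {a, b} = c" using mono_setD[OF m xy(3-5)] by simp
    qed
    then show False using V(4)[OF Q] by (simp add: \<A>_def)
  qed
  have "\<exists>h \<pi>. inj_on h B \<and> h ` B \<subseteq> V \<and> inj_on \<pi> (\<psi>B ` [B]\<^bsup>2\<^esup>) \<and>
         (\<forall>e \<in> EB. h ` e \<in> E \<and> \<chi> (h ` e) = \<pi> (\<psi>B e))"
    if "clique_free_colouring k r V E \<chi>" for \<chi>
  proof -
    have \<chi>: "\<And>e. e \<in> E \<Longrightarrow> \<chi> e < r"
      and nomono: "\<And>Q c. Q \<subseteq> V \<Longrightarrow> card Q = k \<Longrightarrow> [Q]\<^bsup>2\<^esup> \<subseteq> E \<Longrightarrow> \<not> mono_set \<chi> Q c"
      using that unfolding clique_free_colouring_def by blast+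
    have "\<exists>\<psi>. \<forall>(U, F) \<in> set Ps. \<exists>h. inj_on h U \<and> h ` U \<subseteq> V \<and>
       (\<forall>e \<in> F. h ` e \<in> E \<and> \<chi> (h ` e) = \<psi> e)"
      by (rule ramsey[THEN spec, THEN mp]) (use \<chi> in blast)
    then obtain \<psi> where \<psi>1: "\<forall>(U, F) \<in> set Ps. \<exists>h. inj_on h U \<and> h ` U \<subseteq> V \<and>
       (\<forall>e \<in> F. h ` e \<in> E \<and> \<chi> (h ` e) = \<psi> e)" by (elim exE)
    have \<psi>: "\<exists>h. inj_on h U \<and> h ` U \<subseteq> V \<and> (\<forall>e \<in> F. h ` e \<in> E \<and> \<chi> (h ` e) = \<psi> e)"
      if "(U, F) \<in> set Ps" for U F
      using bspec[OF \<psi>1 that] by simp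
    \<comment> \<open>\<open>\<psi>\<close> is known to be below \<open>r\<close> only on pairs
      realised by some copy, whereas \<open>forced\<close> asks for this on all pairs of
      \<open>W\<close>.\<close>
    define \<psi>' where "\<psi>' e = (if \<psi> e < r then \<psi> e else 0)" for e
    have eq: "\<psi>' e = \<chi> f" if "f \<in> E" "\<chi> f = \<psi> e" for e f
      using \<chi>[OF that(1)] that(2) by (simp add: \<psi>'_def)
    have "\<exists>d. mono_set \<psi>0 Q d" if Q: "Q \<subseteq> W" "card Q = k" and m: "mono_set \<psi>' Q c" for Q c
    proof (rule ccontr)
      assume "\<not> ?thesis"
      then have "Q \<in> \<A>" using Q by (simp add: \<A>_def)
      then have "(Q, [Q]\<^bsup>2\<^esup>) \<in> set Ps" by (simp add: Ps_def As)
      then obtain h where h: "inj_on h Q" "h ` Q \<subseteq> V"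
        "\<And>e. e \<in> [Q]\<^bsup>2\<^esup> \<Longrightarrow> h ` e \<in> E \<and> \<chi> (h ` e) = \<psi> e"
        using \<psi> by meson
      have edge: "{a, b} \<in> E \<and> \<chi> {a, b} = c" if ab: "a \<in> h ` Q" "b \<in> h ` Q" "a \<noteq> b" for a b
      proof -
        obtain x y where xy: "a = h x" "b = h y" "x \<in> Q" "y \<in> Q" "x \<noteq> y" using ab by blast
        then have "{a, b} \<in> E" "\<chi> {a, b} = \<psi> {x, y}" using h(3)[of "{x, y}"] by simp_all
        then show ?thesis using eq mono_setD[OF m xy(3-5)] by metis
      qed
      then have "[h ` Q]\<^bsup>2\<^esup> \<subseteq> E" by (auto elim!: nsets2_E)
      moreover have "mono_set \<chi> (h ` Q) c" using edge by (intro mono_setI) blast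
      moreover have "card (h ` Q) = k" using h(1) Q(2) by (simp add: card_image)
      ultimately show False using nomono[OF h(2)] by blast
    qed
    moreover have "\<psi>' e < r" for e using r by (simp add: \<psi>'_def)
    ultimately obtain \<pi> where \<pi>: "inj_on \<pi> (\<psi>B ` [B]\<^bsup>2\<^esup>)" "\<And>e. e \<in> [B]\<^bsup>2\<^esup> \<Longrightarrow> \<psi>' (\<iota> ` e) = \<pi> (\<psi>B e)"
      using forced[of \<psi>'] by blast
    have "(\<iota> ` B, (`) \<iota> ` EB) \<in> set Ps" by (simp add: Ps_def)
    then obtain h where h: "inj_on h (\<iota> ` B)" "h ` \<iota> ` B \<subseteq> V"
      "\<And>e. e \<in> EB \<Longrightarrow> h ` \<iota> ` e \<in> E \<and> \<chi> (h ` \<iota> ` e) = \<psi> (\<iota> ` e)"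
      using \<psi> by (metis imageI)
    have "(h \<circ> \<iota>) ` e \<in> E \<and> \<chi> ((h \<circ> \<iota>) ` e) = \<pi> (\<psi>B e)" if "e \<in> EB" for e
    proof -
      have "e \<in> [B]\<^bsup>2\<^esup>" using that B(2) by blast
      then show ?thesis using h(3)[OF that] eq[of "h ` \<iota> ` e" "\<iota> ` e"] \<pi>(2)[of e] by (simp add: image_comp)
    qed
    moreover have "inj_on (h \<circ> \<iota>) B" using h(1) W(2) by (intro comp_inj_on) (auto intro: inj_on_subset)
    moreover have "(h \<circ> \<iota>) ` B \<subseteq> V" using h(2) by (auto simp: image_comp)
    ultimately show ?thesis using \<pi>(1) by blast
  qed
  moreover have "clique_free_colouring k r V E (\<lambda>e. \<psi>0 (p ` e))"
    using W(4) col unfolding clique_free_colouring_def by blast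
  ultimately show thesis using that V(1,2) by blast
qed

section \<open>Monochromatic cliques and minimal subgraphs\<close>

lemma edges_complete_graph: "edges (complete_graph k) = [{..<k}]\<^bsup>2\<^esup>"
  by (auto simp: edges_def complete_graph_def nsets_def intro: finite_subset)

lemma mono_copy_complete_graph:
  "mono_copy (complete_graph k) G \<chi> \<longleftrightarrow>
     (\<exists>Q c. Q \<subseteq> verts G \<and> card Q = k \<and> finite Q \<and> [Q]\<^bsup>2\<^esup> \<subseteq> edges G \<and> mono_set \<chi> Q c)"
proof
  assume "mono_copy (complete_graph k) G \<chi>"
  then obtain f c where f: "inj_on f {..<k}" "f ` {..<k} \<subseteq> verts G"
    "\<And>e. e \<in> [{..<k}]\<^bsup>2\<^esup> \<Longrightarrow> f ` e \<in> edges G \<and> \<chi> (f ` e) = c"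
    unfolding mono_copy_def edges_complete_graph by (auto simp: complete_graph_def verts_def)
  have edge: "e \<in> edges G \<and> \<chi> e = c" if e: "e \<in> [f ` {..<k}]\<^bsup>2\<^esup>" for e
  proof -
    obtain a b where "e = {a, b}" "a \<in> f ` {..<k}" "b \<in> f ` {..<k}" "a \<noteq> b"
      using e by (elim nsets2_E) blast
    then obtain x y where "e = {f x, f y}" "x < k" "y < k" "x \<noteq> y" by blast
    then show ?thesis using f(3)[of "{x, y}"] by simp
  qed
  have "card (f ` {..<k}) = k" using f(1) by (simp add: card_image)
  moreover have "[f ` {..<k}]\<^bsup>2\<^esup> \<subseteq> edges G" "mono_set \<chi> (f ` {..<k}) c"
    using edge unfolding mono_set_def by blast+
  ultimately show "\<exists>Q c. Q \<subseteq> verts G \<and> card Q = k \<and> finite Q \<and> [Q]\<^bsup>2\<^esup> \<subseteq> edges G \<and> mono_set \<chi> Q c"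
    using f(2) by blast
next
  assume "\<exists>Q c. Q \<subseteq> verts G \<and> card Q = k \<and> finite Q \<and> [Q]\<^bsup>2\<^esup> \<subseteq> edges G \<and> mono_set \<chi> Q c"
  then obtain Q c where Q: "Q \<subseteq> verts G" "card Q = k" "finite Q" "[Q]\<^bsup>2\<^esup> \<subseteq> edges G" "mono_set \<chi> Q c"
    by blast
  obtain f where f: "bij_betw f {..<k} Q"
    using ex_bij_betw_nat_finite[OF Q(3)] Q(2) by (auto simp: atLeast0LessThan)
  have "f ` e \<in> edges G \<and> \<chi> (f ` e) = c" if e: "e \<in> [{..<k}]\<^bsup>2\<^esup>" for e
  proof -
    obtain x y where "e = {x, y}" "x \<in> {..<k}" "y \<in> {..<k}" "x \<noteq> y"
      using e by (elim nsets2_E) blast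
    then have xy: "e = {x, y}" "x < k" "y < k" "x \<noteq> y" by auto
    then have "f x \<in> Q" "f y \<in> Q" "f x \<noteq> f y" using f by (auto simp: bij_betw_def inj_on_def)
    then show ?thesis using Q(4) mono_setD[OF Q(5)] xy(1) by auto
  qed
  then show "mono_copy (complete_graph k) G \<chi>"
    unfolding mono_copy_def edges_complete_graph
    using f Q(1) by (intro exI[of _ f] exI[of _ c]) (auto simp: complete_graph_def verts_def bij_betw_def)
qed

text \<open>Take an arrowing subgraph with the least number of vertices plus edges: a proper
  subgraph of it loses a vertex or an edge.\<close>

lemma ex_ramsey_minimal_subgraph:
  assumes "graph G" "arrows G H r"
  obtains G' where "subgraph G' G" "ramsey_minimal r H G'"
proof -
  define size where "size G = card (verts G) + card (edges G)" for G :: "'a graph"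
  have fin: "finite (verts G) \<and> finite (edges G)" if "graph G" for G :: "'a graph"
  proof -
    have "edges G \<subseteq> Pow (verts G)" using that by (auto simp: graph_def)
    then show ?thesis using that finite_subset by (auto simp: graph_def)
  qed
  have "subgraph G G" using assms(1) by (simp add: subgraph_def)
  then obtain G' where G': "subgraph G' G" "arrows G' H r"
    "\<And>G''. subgraph G'' G \<Longrightarrow> arrows G'' H r \<Longrightarrow> size G' \<le> size G''"
    using ex_has_least_nat[of "\<lambda>G'. subgraph G' G \<and> arrows G' H r" G size] assms(2) by blast
  have "\<not> arrows G'' H r" if sub: "subgraph G'' G'" "G'' \<noteq> G'" for G''
  proof
    assume "arrows G'' H r"
    moreover have "subgraph G'' G" using sub(1) G'(1) by (auto simp: subgraph_def)
    ultimately have "size G' \<le> size G''" using G'(3) by blast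
    moreover have fin': "finite (verts G')" "finite (edges G')" using fin G'(1) by (auto simp: subgraph_def)
    moreover have "verts G'' \<noteq> verts G' \<or> edges G'' \<noteq> edges G'"
      using sub(2) by (auto simp: verts_def edges_def prod_eq_iff)
    then have "verts G'' \<subset> verts G' \<or> edges G'' \<subset> edges G'" using sub(1) by (auto simp: subgraph_def)
    moreover have "card (verts G'') \<le> card (verts G')" "card (edges G'') \<le> card (edges G')"
      using sub(1) fin' by (auto simp: subgraph_def intro: card_mono)
    ultimately show False
      unfolding size_def using psubset_card_mono[OF fin'(1), of "verts G''"] psubset_card_mono[OF fin'(2), of "edges G''"]
      by linarith
  qed
  then have "ramsey_minimal r H G'" using G' by (auto simp: ramsey_minimal_def subgraph_def)
  then show thesis using that G'(1) by blast
qed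

section \<open>Attaching apex vertices and bounding the degree\<close>

theorem theorem3:
  fixes k r :: nat
  assumes "k \<ge> 3" and "r \<ge> 3"
  shows "s_ramsey r (complete_graph k) \<le> 8 * (k - 1) ^ 6 * r ^ 3"
proof -
  have k: "k \<ge> 3" and r: "r > 0" and m: "k - 1 \<ge> 2" and Suc_m: "Suc (k - 1) = k" using assms by auto
  obtain n :: nat and EB :: "nat set set" and \<psi>B where n: "n > 0" "n \<le> 8 * (k - 1) ^ 6 * r ^ 3"
    and EB: "EB \<subseteq> [{..<n}]\<^bsup>2\<^esup>" and \<psi>B: "\<And>e. \<psi>B e < r"
    and free: "\<And>Q c. Q \<subseteq> {..<n} \<Longrightarrow> card Q = Suc (k - 1) \<Longrightarrow> [Q]\<^bsup>2\<^esup> \<subseteq> EB \<Longrightarrow> \<not> mono_set \<psi>B Q c"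
    and rich: "\<And>f. (\<And>v. v < n \<Longrightarrow> f v < r) \<Longrightarrow>
       \<exists>i < r. \<exists>Q \<subseteq> {..<n}. card Q = k - 1 \<and> [Q]\<^bsup>2\<^esup> \<subseteq> EB \<and> mono_set \<psi>B Q i \<and> (\<forall>v \<in> Q. f v = i)"
    using colour_pattern[OF m r] by blast
  obtain V :: "nat set" and E and \<chi>0 where V: "finite V" "E \<subseteq> [V]\<^bsup>2\<^esup>"
    and \<chi>0: "clique_free_colouring k r V E \<chi>0"
    and forced: "\<And>\<chi>. clique_free_colouring k r V E \<chi> \<Longrightarrow>
       \<exists>h \<pi>. inj_on h {..<n} \<and> h ` {..<n} \<subseteq> V \<and> inj_on \<pi> (\<psi>B ` [{..<n}]\<^bsup>2\<^esup>) \<and>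
         (\<forall>e \<in> EB. h ` e \<in> E \<and> \<chi> (h ` e) = \<pi> (\<psi>B e))"
    by (rule forcing_graph[where \<psi>B = \<psi>B and EB = EB, OF k r finite_lessThan EB \<psi>B])
      (rule free[unfolded Suc_m], assumption+, rule that)
  \<comment> \<open>The place of the pattern in \<open>V\<close> depends on the colouring, so every
    \<open>n\<close>-subset receives an apex.\<close>
  define \<S> where "\<S> = {S. S \<subseteq> V \<and> card S = n}"
  have fin\<S>: "finite \<S>" by (rule finite_subset[of _ "Pow V"]) (auto simp: \<S>_def V)
  obtain b where "bij_betw b \<S> {0..<card \<S>}" using ex_bij_betw_finite_nat[OF fin\<S>] by blast
  then have b: "inj_on b \<S>" by (rule bij_betw_imp_inj_on)
  \<comment> \<open>Apices lie above all elements of \<open>V\<close>, and \<open>b\<close>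
    separates them from each other. \<open>insert 0\<close> gives \<open>Max\<close> a nonempty
    set.\<close>
  define apex where "apex S = Suc (Max (insert 0 V)) + b S" for S
  have apex_V: "apex S \<notin> V" for S
  proof
    assume "apex S \<in> V"
    then have "apex S \<le> Max (insert 0 V)" using V(1) by simp
    then show False by (simp add: apex_def)
  qed
  have apex_inj: "S = T" if "S \<in> \<S>" "T \<in> \<S>" "apex S = apex T" for S T
    using that b by (auto simp: apex_def inj_on_def)
  define spokes where "spokes S = (\<lambda>s. {apex S, s}) ` S" for S
  define G where "G = (V \<union> apex ` \<S>, E \<union> (\<Union>S\<in>\<S>. spokes S))"
  have vG: "verts G = V \<union> apex ` \<S>" and eG: "edges G = E \<union> (\<Union>S\<in>\<S>. spokes S)"
    by (simp_all add: G_def verts_def edges_def)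
  have E2: "e \<subseteq> V \<and> card e = 2" if "e \<in> E" for e using that V(2) by (auto simp: nsets_def)
  have spoke: "e \<subseteq> verts G \<and> card e = 2" if Se: "S \<in> \<S>" "e \<in> spokes S" for S e
  proof -
    obtain s where s: "s \<in> S" "e = {apex S, s}" using Se(2) by (auto simp: spokes_def)
    then have "s \<in> V" using Se(1) by (auto simp: \<S>_def)
    moreover then have "apex S \<noteq> s" using apex_V by metis
    ultimately show ?thesis using s Se(1) by (auto simp: vG)
  qed
  have "graph G" unfolding graph_def
    using V(1) fin\<S> E2 spoke by (auto simp: vG eG)
  have "arrows G (complete_graph k) r"
    unfolding arrows_def
  proof (intro allI impI)
    fix \<chi> :: "nat set \<Rightarrow> nat" assume \<chi>: "\<forall>e \<in> edges G. \<chi> e < r"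
    show "mono_copy (complete_graph k) G \<chi>"
    proof (cases "\<exists>Q c. Q \<subseteq> V \<and> card Q = k \<and> [Q]\<^bsup>2\<^esup> \<subseteq> E \<and> mono_set \<chi> Q c")
      case True
      then obtain Q c where Q: "Q \<subseteq> V" "card Q = k" "[Q]\<^bsup>2\<^esup> \<subseteq> E" "mono_set \<chi> Q c" by blast
      moreover have "finite Q" using Q(1) V(1) finite_subset by blast
      moreover have "Q \<subseteq> verts G" "[Q]\<^bsup>2\<^esup> \<subseteq> edges G" using Q by (auto simp: vG eG)
      ultimately show ?thesis unfolding mono_copy_complete_graph by blast
    next
      case False
      have "\<exists>h \<pi>. inj_on h {..<n} \<and> h ` {..<n} \<subseteq> V \<and> inj_on \<pi> (\<psi>B ` [{..<n}]\<^bsup>2\<^esup>) \<and>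
         (\<forall>e \<in> EB. h ` e \<in> E \<and> \<chi> (h ` e) = \<pi> (\<psi>B e))"
        by (rule forced) (use \<chi> eG False in \<open>auto simp: clique_free_colouring_def\<close>)
      then obtain h \<pi> where h: "inj_on h {..<n}" "h ` {..<n} \<subseteq> V" and \<pi>: "inj_on \<pi> (\<psi>B ` [{..<n}]\<^bsup>2\<^esup>)"
        and hE: "\<And>e. e \<in> EB \<Longrightarrow> h ` e \<in> E \<and> \<chi> (h ` e) = \<pi> (\<psi>B e)" by blast
      define S where "S = h ` {..<n}"
      have S: "S \<in> \<S>" using h by (simp add: S_def \<S>_def card_image)
      have spoke_in: "{apex S, h v} \<in> edges G" if "v < n" for v
        using that S by (auto simp: eG spokes_def S_def)
      \<comment> \<open>Applied to the constant colouring \<open>i\<close>, \<open>rich\<close>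
        yields an edge of pattern colour \<open>i\<close>, since \<open>k - 1 \<ge> 2\<close>. Hence
        \<open>\<pi>\<close> permutes all \<open>r\<close> colours.\<close>
      have used: "\<exists>e \<in> EB. \<psi>B e = i" if i: "i < r" for i
      proof -
        obtain i' Q where Q: "Q \<subseteq> {..<n}" "card Q = k - 1" "[Q]\<^bsup>2\<^esup> \<subseteq> EB" "mono_set \<psi>B Q i'"
          "\<forall>v \<in> Q. i = i'"
          using rich[of "\<lambda>_. i"] i by blast
        have "finite Q" using Q(1) finite_subset by blast
        then have "[Q]\<^bsup>2\<^esup> \<noteq> {}" using Q(2) m by (simp add: nsets_eq_empty_iff)
        then obtain e where e: "e \<in> [Q]\<^bsup>2\<^esup>" by blast
        then have "Q \<noteq> {}" by (auto simp: nsets_def)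
        then have "i = i'" using Q(5) by blast
        then show ?thesis using e Q(3,4) unfolding mono_set_def by blast
      qed
      have "{..<r} \<subseteq> \<psi>B ` [{..<n}]\<^bsup>2\<^esup>" using used EB by fastforce
      then have \<pi>_inj: "inj_on \<pi> {..<r}" using \<pi> inj_on_subset by blast
      moreover have "\<pi> ` {..<r} \<subseteq> {..<r}"
      proof
        fix j assume "j \<in> \<pi> ` {..<r}"
        then obtain i where "i < r" "j = \<pi> i" by blast
        then obtain e where e: "e \<in> EB" "j = \<chi> (h ` e)" using used hE by metis
        then have "h ` e \<in> edges G" using hE by (simp add: eG)
        then show "j \<in> {..<r}" using \<chi> e(2) by simp
      qed
      ultimately have \<pi>_surj: "\<pi> ` {..<r} = {..<r}" by (simp add: endo_inj_surj)
      \<comment> \<open>Through \<open>\<pi>\<close> the colours of the spokes become a vertex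
        colouring \<open>f\<close> of the pattern. The set \<open>Q\<close> that \<open>rich\<close>
        finds for it is completed by the apex to a monochromatic \<open>k\<close>-clique.\<close>
      have "\<exists>i. i < r \<and> \<pi> i = \<chi> {apex S, h v}" if "v < n" for v
      proof -
        have "\<chi> {apex S, h v} \<in> \<pi> ` {..<r}" using \<pi>_surj \<chi> spoke_in[OF that] by simp
        then show ?thesis by auto
      qed
      then obtain f where f: "\<And>v. v < n \<Longrightarrow> f v < r \<and> \<pi> (f v) = \<chi> {apex S, h v}" by metis
      then obtain i Q where Q: "i < r" "Q \<subseteq> {..<n}" "card Q = k - 1" "[Q]\<^bsup>2\<^esup> \<subseteq> EB" "mono_set \<psi>B Q i"
          "\<And>v. v \<in> Q \<Longrightarrow> f v = i"
        using rich[of f] by blast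
      define R where "R = insert (apex S) (h ` Q)"
      have finQ: "finite Q" using Q(2) finite_subset by blast
      have hQV: "h ` Q \<subseteq> V" using Q(2) h(2) by blast
      have "card (h ` Q) = k - 1" using Q(2,3) h(1) card_image inj_on_subset by metis
      moreover have "apex S \<notin> h ` Q" using hQV apex_V by blast
      ultimately have cR: "card R = k" unfolding R_def using finQ k by simp
      have apex_edge: "{apex S, x} \<in> edges G \<and> \<chi> {apex S, x} = \<pi> i" if x: "x \<in> h ` Q" for x
      proof -
        obtain v where v: "v \<in> Q" "x = h v" using x by blast
        then have "v < n" using Q(2) by auto
        then show ?thesis using spoke_in f Q(6) v by metis
      qed
      have base_edge: "{x, y} \<in> edges G \<and> \<chi> {x, y} = \<pi> i" if xy: "x \<in> h ` Q" "y \<in> h ` Q" "x \<noteq> y" for x y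
      proof -
        obtain u v where uv: "u \<in> Q" "x = h u" "v \<in> Q" "y = h v" "u \<noteq> v" using xy by blast
        then have "{u, v} \<in> EB" using Q(4) by auto
        then show ?thesis using hE[of "{u, v}"] mono_setD[OF Q(5) uv(1,3,5)] uv by (simp add: eG)
      qed
      have edge: "{x, y} \<in> edges G \<and> \<chi> {x, y} = \<pi> i" if "x \<in> R" "y \<in> R" "x \<noteq> y" for x y
        using that apex_edge base_edge unfolding R_def by (metis insert_commute insert_iff)
      then have "mono_set \<chi> R (\<pi> i)" by (intro mono_setI) blast
      moreover have "[R]\<^bsup>2\<^esup> \<subseteq> edges G"
      proof
        fix e assume "e \<in> [R]\<^bsup>2\<^esup>"
        then show "e \<in> edges G" using edge by (elim nsets2_E) simp
      qed
      moreover have "R \<subseteq> verts G" using hQV S by (auto simp: R_def vG)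
      moreover have "finite R" using finQ by (simp add: R_def)
      ultimately show ?thesis unfolding mono_copy_complete_graph using cR by blast
    qed
  qed
  then obtain G' where G': "subgraph G' G" "ramsey_minimal r (complete_graph k) G'"
    using ex_ramsey_minimal_subgraph[OF \<open>graph G\<close>] by blast
  have gG': "graph G'" and aG': "arrows G' (complete_graph k) r" using G'(2) by (auto simp: ramsey_minimal_def)
  \<comment> \<open>Without an apex \<open>G'\<close> would lie inside the graph on \<open>V\<close>
    with edges \<open>E\<close>, where \<open>\<chi>0\<close> has no monochromatic clique.\<close>
  have "\<exists>S \<in> \<S>. apex S \<in> verts G'"
  proof (rule ccontr)
    assume no: "\<not> ?thesis"
    then have vV: "verts G' \<subseteq> V" using G'(1) by (auto simp: subgraph_def vG)
    have eE: "edges G' \<subseteq> E"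
    proof
      fix e assume e: "e \<in> edges G'"
      then have "e \<subseteq> V" using gG' vV by (auto simp: graph_def)
      moreover have "e \<notin> spokes S" if "S \<in> \<S>" for S
        using \<open>e \<subseteq> V\<close> apex_V by (auto simp: spokes_def)
      ultimately show "e \<in> E" using e G'(1) by (auto simp: subgraph_def eG)
    qed
    have "mono_copy (complete_graph k) G' \<chi>0" using aG' \<chi>0 eE unfolding arrows_def clique_free_colouring_def by blast
    then obtain Q c where "Q \<subseteq> verts G'" "card Q = k" "[Q]\<^bsup>2\<^esup> \<subseteq> edges G'" "mono_set \<chi>0 Q c"
      unfolding mono_copy_complete_graph by blast
    moreover then have "Q \<subseteq> V" "[Q]\<^bsup>2\<^esup> \<subseteq> E" using vV eE by blast+
    ultimately show False using \<chi>0 unfolding clique_free_colouring_def by blast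
  qed
  then obtain S where S: "S \<in> \<S>" "apex S \<in> verts G'" by blast
  have finS: "finite S" "card S = n" using S(1) V(1) finite_subset by (auto simp: \<S>_def)
  \<comment> \<open>Apices are adjacent to vertices of \<open>V\<close> only and differ for
    different sets, so only the \<open>n\<close> spokes of \<open>S\<close> remain.\<close>
  have "{e \<in> edges G'. apex S \<in> e} \<subseteq> spokes S"
  proof
    fix e assume e: "e \<in> {e \<in> edges G'. apex S \<in> e}"
    then have "e \<in> edges G" using G'(1) by (auto simp: subgraph_def)
    moreover have "e \<notin> E" using e E2 apex_V by blast
    ultimately obtain T where T: "T \<in> \<S>" "e \<in> spokes T" by (auto simp: eG)
    then obtain s where s: "s \<in> T" "e = {apex T, s}" by (auto simp: spokes_def)
    then have "s \<in> V" using T(1) by (auto simp: \<S>_def)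
    then have "apex S = apex T" using e s(2) apex_V by auto
    then show "e \<in> spokes S" using apex_inj[OF S(1) T(1)] T(2) by simp
  qed
  then have "Defs.degree G' (apex S) \<le> card (spokes S)"
    unfolding Defs.degree_def using finS by (intro card_mono) (auto simp: spokes_def)
  also have "\<dots> \<le> n" using card_image_le[OF finS(1)] finS(2) by (simp add: spokes_def)
  finally have "Defs.degree G' (apex S) \<le> n" .
  moreover have "min_degree G' \<le> Defs.degree G' (apex S)"
    unfolding min_degree_def using S(2) gG' by (intro Min_le) (auto simp: graph_def)
  moreover have "s_ramsey r (complete_graph k) \<le> min_degree G'"
    unfolding s_ramsey_def using G'(2) by (intro wellorder_Inf_le1) blast
  ultimately show ?thesis using n(2) by linarith
qed

end
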